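(* There is a constant $C>0$ depending only on $V$ such that for all $k_F\ge1$ (with $N=|B_F|$), all $\kappa>0$, and every normalized eigenvector $\Psi\in D(H'_{\mathrm{kin}})$ of $H_N$ with $\langle\Psi,H_N\Psi\rangle\le E_{\mathrm{FS}}+\kappa k_F$, $$\big\langle\Psi,\big(H'_{\mathrm{kin}}+k_F^{-1}\mathcal N_EH'_{\mathrm{kin}}\big)\Psi\big\rangle\le C(\kappa+1)^2k_F.$$
   Context: Let $\mathbb T^3=[0,2\pi]^3$ with periodic boundary conditions and $V:\mathbb T^3\to\mathbb R$ a potential with Fourier coefficients $\hat V_k=\int_{\mathbb T^3}V(x)e^{-ik\cdot x}dx$ ($k\in\mathbb Z^3$) satisfying $\hat V_k\ge0$, $\hat V_{-k}=\hat V_k$ and $\sum_{k\in\mathbb Z^3}\hat V_k|k|<\infty$. For $k_F>0$ let $B_F=\overline B(0,k_F)\cap\mathbb Z^3$, $B_F^c=\mathbb Z^3\setminus B_F$, $N=|B_F|$. Let $\mathcal H_N=\bigwedge^N L^2(\mathbb T^3)$ and $H_N=\sum_{i=1}^N(-\Delta_i)+k_F^{-1}\sum_{1\le i<j\le N}V(x_i-x_j)$ with domain $\bigwedge^N H^2(\mathbb T^3)$. Let $u_p(x)=(2\pi)^{-3/2}e^{ip\cdot x}$ and $c_p,c_p^*$ the fermionic annihilation/creation operators of $u_p$. Let $\psi_{\mathrm{FS}}=\bigwedge_{p\in B_F}u_p$ and $E_{\mathrm{FS}}=\langle\psi_{\mathrm{FS}},H_N\psi_{\mathrm{FS}}\rangle$.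 On $\mathcal H_N$ let $H'_{\mathrm{kin}}=\sum_{p\in B_F^c}|p|^2c_p^*c_p-\sum_{p\in B_F}|p|^2c_pc_p^*$ (equal to $\sum_i(-\Delta_i)-\sum_{p\in B_F}|p|^2\ge0$) and $\mathcal N_E=\sum_{p\in B_F^c}c_p^*c_p$; these commute, so $\mathcal N_EH'_{\mathrm{kin}}\ge0$. *)

theory Defs
  imports "HOL-Analysis.Analysis"
begin

text \<open>Momentum-space (second quantized) representation of the N-fermion space on the
 torus: a state is given by its coefficients in the orthonormal Slater-determinant basis
 Phi_S = c^*_{q1} ... c^*_{qN} Omega (q1 < ... < qN in a fixed total order of Z^3),
 indexed by finite sets S of momenta.\<close>

type_synonym mom = "int \<times> int \<times> int"
type_synonym state = "mom set \<Rightarrow> complex"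

definition madd :: "mom \<Rightarrow> mom \<Rightarrow> mom" where
  "madd p q = (case p of (a,b,c) \<Rightarrow> case q of (a',b',c') \<Rightarrow> (a+a', b+b', c+c'))"

definition mneg :: "mom \<Rightarrow> mom" where
  "mneg p = (case p of (a,b,c) \<Rightarrow> (-a, -b, -c))"

definition msub :: "mom \<Rightarrow> mom \<Rightarrow> mom" where
  "msub p q = madd p (mneg q)"

definition msq :: "mom \<Rightarrow> real" where
  "msq p = (case p of (a,b,c) \<Rightarrow> real_of_int (a^2 + b^2 + c^2))"

definition mnorm :: "mom \<Rightarrow> real" where
  "mnorm p = sqrt (msq p)"

definition mless :: "mom \<Rightarrow> mom \<Rightarrow> bool" where
  "mless p q = (case p of (a,b,c) \<Rightarrow> case q of (a',b',c') \<Rightarrow>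
      a < a' \<or> (a = a' \<and> (b < b' \<or> (b = b' \<and> c < c'))))"

definition fsign :: "mom \<Rightarrow> mom set \<Rightarrow> complex" where
  "fsign p S = (-1) ^ card {q \<in> S. mless q p}"

definition ann :: "mom \<Rightarrow> state \<Rightarrow> state" where
  "ann p \<Psi> S = (if p \<notin> S then fsign p S * \<Psi> (insert p S) else 0)"

definition cre :: "mom \<Rightarrow> state \<Rightarrow> state" where
  "cre p \<Psi> S = (if p \<in> S then fsign p (S - {p}) * \<Psi> (S - {p}) else 0)"

definition fermi_ball :: "real \<Rightarrow> mom set" where
  "fermi_ball kF = {p. mnorm p \<le> kF}"

text \<open>Kinetic energy sum_i (-Delta_i) = sum_p |p|^2 c_p^* c_p\<close>
definition kin :: "state \<Rightarrow> state" where
  "kin \<Psi> S = (\<Sum>\<^sub>\<infinity>p\<in>UNIV. of_real (msq p) * cre p (ann p \<Psi>) S)"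

text \<open>Interaction sum_{i<j} V(x_i - x_j)
  = (2 (2 pi)^3)^{-1} sum_{k,p,q} Vhat_k c^*_{p+k} c^*_{q-k} c_q c_p
  (with V(x) = (2 pi)^{-3} sum_k Vhat_k e^{ik.x})\<close>
definition inter :: "(mom \<Rightarrow> real) \<Rightarrow> state \<Rightarrow> state" where
  "inter Vh \<Psi> S = of_real (1 / (2 * (2 * pi) ^ 3)) *
     (\<Sum>\<^sub>\<infinity>(k,p,q)\<in>UNIV. of_real (Vh k) *
        cre (madd p k) (cre (msub q k) (ann q (ann p \<Psi>))) S)"

definition HN :: "(mom \<Rightarrow> real) \<Rightarrow> real \<Rightarrow> state \<Rightarrow> state" where
  "HN Vh kF \<Psi> S = kin \<Psi> S + of_real (1 / kF) * inter Vh \<Psi> S"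

definition Hkin' :: "real \<Rightarrow> state \<Rightarrow> state" where
  "Hkin' kF \<Psi> S =
     (\<Sum>\<^sub>\<infinity>p\<in>- fermi_ball kF. of_real (msq p) * cre p (ann p \<Psi>) S)
   - (\<Sum>p\<in>fermi_ball kF. of_real (msq p) * ann p (cre p \<Psi>) S)"

definition NE :: "real \<Rightarrow> state \<Rightarrow> state" where
  "NE kF \<Psi> S = (\<Sum>\<^sub>\<infinity>p\<in>- fermi_ball kF. cre p (ann p \<Psi>) S)"

definition sinner :: "state \<Rightarrow> state \<Rightarrow> complex" where
  "sinner \<Phi> \<Psi> = (\<Sum>\<^sub>\<infinity>S\<in>UNIV. cnj (\<Phi> S) * \<Psi> S)"

definition psiFS :: "real \<Rightarrow> state" where
  "psiFS kF S = (if S = fermi_ball kF then 1 else 0)"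

definition EFS :: "(mom \<Rightarrow> real) \<Rightarrow> real \<Rightarrow> real" where
  "EFS Vh kF = Re (sinner (psiFS kF) (HN Vh kF (psiFS kF)))"

text \<open>Psi is an element of wedge^N L^2(T^3): supported on N-element sets, square summable\<close>
definition in_HN_space :: "nat \<Rightarrow> state \<Rightarrow> bool" where
  "in_HN_space N \<Psi> \<longleftrightarrow> (\<forall>S. \<Psi> S \<noteq> 0 \<longrightarrow> finite S \<and> card S = N)
      \<and> (\<lambda>S. (cmod (\<Psi> S))^2) summable_on UNIV"

definition in_dom_Hkin' :: "real \<Rightarrow> state \<Rightarrow> bool" where
  "in_dom_Hkin' kF \<Psi> \<longleftrightarrow> in_HN_space (card (fermi_ball kF)) \<Psi>
      \<and> (\<lambda>S. (cmod (Hkin' kF \<Psi> S))^2) summable_on UNIV"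

end

(* With \<rho>_k = \<Sum>_p c*_{p-k} c_p the Hamiltonian is
     H_N = E_FS + H'_kin + (2 (2 pi)^3 k_F)^{-1} \<Sum>_{k \<noteq> 0} V_k (\<rho>_k^* \<rho>_k - ||\<rho>_k psi_FS||^2).
   Here ||\<rho>_k psi_FS||^2 is controlled by the number of lattice points p outside the Fermi ball with
   p - k inside it, which is O(k_F^2 |k|). Since V_k \<ge> 0, testing the eigenvalue equation
   against Psi bounds both <H'_kin> and k_F^{-1} \<Sum>_k V_k ||\<rho>_k Psi||^2 by O((\<kappa> + 1) k_F), and
   N_E \<le> H'_kin. Testing it against N_E Psi, the only term without a sign is
   <[\<rho>_k, N_E] Psi, \<rho>_k Psi>; the commutator only involves hops across the Fermi surface, so its
   square is at most 2 #lune * (2 <N_E> + 1), and the other factor is bounded by the first estimate. *)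

theory Submission
  imports Defs
begin

section \<open>Anticommutation relations and density operators\<close>

text \<open>The argument closes by power counting. A lune has O(k_F^2 |k|) points, so the prefactor
  1/k_F and the summability of V_k |k| turn every lune-sized error into O(k_F). The operator bound
  by N, which is of order k_F^3, would be far too large; it serves convergence only. The term k = 0
  has no small bound either, since \<open>rho 0\<close> is multiplication by N. It has to cancel
  exactly against the Fermi sea, and so does the normal-ordering constant -N in each summand. In the
  test against N_E Psi the commutator term is split by the arithmetic-geometric inequality: half of
  the squared commutator costs O(k_F (<N_E> + 1)), and the other half is the density sum already
  controlled by the test against Psi. Inserting <N_E> = O((\<kappa> + 1) k_F) gives k_F^2 (\<kappa>
  + 1)^2, whence the weight 1/k_F and the square in the claim. For fixed N all \<open>rho k\<close>
  are bounded uniformly in k and N_E is at most N. The only unbounded operator is the kinetic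
  energy, which is diagonal in the Slater basis; everything therefore becomes a question about
  absolutely convergent sums.\<close>

lemma madd_eq: "madd p q = p + q"
  by (cases p; cases q) (simp add: madd_def)

lemma mneg_eq: "mneg p = - p"
  by (cases p) (simp add: mneg_def)

lemma msub_eq: "msub p q = p - q"
  by (simp add: msub_def madd_eq mneg_eq)

lemma mless_antisym: "p \<noteq> q \<Longrightarrow> mless p q \<longleftrightarrow> \<not> mless q p"
  by (cases p; cases q) (auto simp: mless_def)

lemma fsign_square [simp]: "fsign p S * fsign p S = 1"
  by (simp add: fsign_def flip: power_add)

lemma fsign_square_left [simp]: "fsign p S * (fsign p S * x) = x"
  by (simp flip: mult.assoc)

lemma cnj_fsign [simp]: "cnj (fsign p S) = fsign p S"
  by (simp add: fsign_def)

lemma cmod_fsign [simp]: "cmod (fsign p S) = 1"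
  by (simp add: fsign_def norm_power)

lemma fsign_insert:
  assumes "finite S" "q \<notin> S"
  shows "fsign p (insert q S) = (if mless q p then - fsign p S else fsign p S)"
proof -
  have "{r \<in> insert q S. mless r p} = (if mless q p then insert q {r \<in> S. mless r p} else {r \<in> S. mless r p})"
    by auto
  thus ?thesis using assms by (simp add: fsign_def)
qed

lemma fsign_Diff:
  assumes "finite S" "q \<in> S"
  shows "fsign p (S - {q}) = (if mless q p then - fsign p S else fsign p S)"
proof -
  have "fsign p S = (if mless q p then - fsign p (S - {q}) else fsign p (S - {q}))"
    using fsign_insert[of "S - {q}" q p] assms by (simp add: insert_absorb)
  thus ?thesis by (auto split: if_splits)
qed

text \<open>Exactly one of two distinct momenta precedes the other, so changing the order of removal
  flips exactly one of the two signs.\<close>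

lemma ann_ann:
  assumes "finite S"
  shows "ann p (ann q \<Psi>) S = - ann q (ann p \<Psi>) S"
proof (cases "p = q \<or> p \<in> S \<or> q \<in> S")
  case True thus ?thesis by (auto simp: ann_def)
next
  case False
  hence "mless p q \<longleftrightarrow> \<not> mless q p" by (intro mless_antisym) auto
  with False assms show ?thesis
    by (auto simp: ann_def fsign_insert insert_commute)
qed

lemma ann_cre:
  assumes "finite S"
  shows "ann p (cre q \<Psi>) S = (if p = q then \<Psi> S else 0) - cre q (ann p \<Psi>) S"
proof (cases "p = q")
  case True
  thus ?thesis by (auto simp: ann_def cre_def insert_absorb)
next
  case False
  hence m: "mless p q \<longleftrightarrow> \<not> mless q p" by (rule mless_antisym)
  show ?thesis
  proof (cases "p \<in> S \<or> q \<notin> S")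
    case True thus ?thesis using False by (auto simp: ann_def cre_def)
  next
    case F: False
    have "insert p S - {q} = insert p (S - {q})" using False by auto
    with F False m assms show ?thesis
      by (auto simp: ann_def cre_def fsign_insert fsign_Diff)
  qed
qed

lemma cre_ann_same: "cre p (ann p \<Psi>) S = (if p \<in> S then \<Psi> S else 0)"
  by (auto simp: ann_def cre_def insert_absorb)

lemma ann_cre_same: "ann p (cre p \<Psi>) S = (if p \<in> S then 0 else \<Psi> S)"
  by (auto simp: ann_def cre_def)

lemma cre_cong: "(a \<in> S \<Longrightarrow> f (S - {a}) = g (S - {a})) \<Longrightarrow> cre a f S = cre a g S"
  by (simp add: cre_def)

lemma cre_neg: "cre a (\<lambda>S. - f S) S = - cre a f S"
  by (simp add: cre_def)

text \<open>With \<open>a = p - k\<close> this is the sum over p of c*_{p-k} c_p. For finite S the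
  restriction to \<open>a \<in> S\<close> loses nothing, because \<open>cre a\<close> vanishes at S
  otherwise, and each coefficient is a finite sum.\<close>

definition rho :: "mom \<Rightarrow> state \<Rightarrow> state" where
  "rho k \<Psi> S = (\<Sum>a\<in>S. cre a (ann (a + k) \<Psi>) S)"

lemma rho_superset:
  assumes "finite F" "S \<subseteq> F"
  shows "rho k \<Psi> S = (\<Sum>a\<in>F. cre a (ann (a + k) \<Psi>) S)"
  unfolding rho_def
  by (rule sum.mono_neutral_left) (use assms in \<open>auto simp: cre_def\<close>)

text \<open>Normal ordering: moving c_{a-k} past c*_b leaves the contact term
  \<open>b = a - k\<close>, which becomes the number operator of \<open>a\<close> and adds up to
  \<open>card S\<close>. In the remaining term the signs of two exchanges cancel.\<close>

lemma rho_rho: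
  assumes fin: "finite S"
  shows "rho (- k) (rho k \<Psi>) S - of_nat (card S) * \<Psi> S =
    (\<Sum>a\<in>S. \<Sum>b\<in>S. cre a (cre b (ann (b + k) (ann (a - k) \<Psi>))) S)"
proof -
  have "cre a (ann (a - k) (rho k \<Psi>)) S
      = \<Psi> S + (\<Sum>b\<in>S. cre a (cre b (ann (b + k) (ann (a - k) \<Psi>))) S)"
    if a: "a \<in> S" for a
  proof -
    \<comment> \<open>The inner \<open>rho\<close> is evaluated at \<open>insert (a - k) R\<close>,
      which need not lie in S. Summing over one fixed finite superset lets \<open>ann\<close> pass
      through the sum.\<close>
    define F where "F = insert (a - k) S"
    have F: "finite F" using fin by (simp add: F_def)
    define R where "R = S - {a}"
    have R: "finite R" "insert (a - k) R \<subseteq> F" using fin by (auto simp: R_def F_def)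
    have "ann (a - k) (rho k \<Psi>) R = (\<Sum>b\<in>F. ann (a - k) (cre b (ann (b + k) \<Psi>)) R)"
      unfolding ann_def[of "a - k"] using rho_superset[OF F R(2), of k \<Psi>]
      by (simp add: sum_distrib_left)
    also have "\<dots> = (\<Sum>b\<in>F. (if a - k = b then ann a \<Psi> R else 0)
                   + cre b (ann (b + k) (ann (a - k) \<Psi>)) R)"
    proof (rule sum.cong[OF refl])
      fix b
      have "cre b (ann (a - k) (ann (b + k) \<Psi>)) R = cre b (\<lambda>S. - ann (b + k) (ann (a - k) \<Psi>) S) R"
        by (rule cre_cong) (use R in \<open>simp add: ann_ann[of _ "a - k"]\<close>)
      thus "ann (a - k) (cre b (ann (b + k) \<Psi>)) R = (if a - k = b then ann a \<Psi> R else 0)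
                   + cre b (ann (b + k) (ann (a - k) \<Psi>)) R"
        using R(1) by (auto simp: ann_cre cre_neg)
    qed
    also have "\<dots> = ann a \<Psi> R + (\<Sum>b\<in>F. cre b (ann (b + k) (ann (a - k) \<Psi>)) R)"
      using F by (simp add: sum.distrib F_def)
    also have "(\<Sum>b\<in>F. cre b (ann (b + k) (ann (a - k) \<Psi>)) R)
             = (\<Sum>b\<in>S. cre b (ann (b + k) (ann (a - k) \<Psi>)) R)"
      by (rule sum.mono_neutral_right) (use F in \<open>auto simp: F_def R_def cre_def\<close>)
    finally have "fsign a R * ann (a - k) (rho k \<Psi>) R =
        fsign a R * ann a \<Psi> R + (\<Sum>b\<in>S. fsign a R * cre b (ann (b + k) (ann (a - k) \<Psi>)) R)"
      by (simp add: distrib_left sum_distrib_left)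
    moreover have "cre a (ann a \<Psi>) S = \<Psi> S" using a by (simp add: cre_ann_same)
    ultimately show ?thesis using a
      by (simp add: cre_def[of a] R_def)
  qed
  thus ?thesis unfolding rho_def[of "- k"] by (simp add: sum.distrib)
qed

lemma summable_on_norm_le:
  fixes f :: "'a \<Rightarrow> 'b :: banach"
  assumes "g summable_on A" "\<And>x. x \<in> A \<Longrightarrow> norm (f x) \<le> g x"
  shows "f summable_on A"
  using abs_summable_summable Infinite_Sum.abs_summable_on_comparison_test'[OF assms] by blast

text \<open>Even at a single S the triple sum is infinite: the created momenta p + k and q - k are
  confined to S, but k stays free. Summability of V and a common bound on the coefficients make it
  absolutely convergent, so that k can be made the outer variable.\<close>

lemma inter_eq:
  assumes fin: "finite S" and "Vh summable_on UNIV" and "\<And>k. Vh k \<ge> 0"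
    and bnd: "\<And>S'. finite S' \<Longrightarrow> card S' = card S \<Longrightarrow> cmod (\<Psi> S') \<le> M"
  shows "inter Vh \<Psi> S = of_real (1 / (2 * (2 * pi) ^ 3)) *
     (\<Sum>\<^sub>\<infinity>k. of_real (Vh k) * (rho (- k) (rho k \<Psi>) S - of_nat (card S) * \<Psi> S))"
proof -
  define t where "t k a b = cre a (cre b (ann (b + k) (ann (a - k) \<Psi>))) S" for k a b
  have t0: "t k a b = 0" if "a \<notin> S \<or> b \<notin> S" for k a b
    using that by (auto simp: t_def cre_def)
  have M: "M \<ge> 0" using bnd[OF fin refl] norm_ge_zero order_trans by blast
  \<comment> \<open>A nonzero term is a sign times the coefficient of \<Psi> at a set of the same
    size as S.\<close>
  have tM: "cmod (t k a b) \<le> M" for k a b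
  proof (cases "a \<in> S \<and> b \<in> S - {a} \<and> b + k \<notin> S - {a} - {b} \<and> a - k \<notin> insert (b + k) (S - {a} - {b})")
    case True
    hence "card (insert (a - k) (insert (b + k) (S - {a} - {b}))) = card S"
    proof -
      have "Suc (card (S - {a})) = card S" "Suc (card (S - {a} - {b})) = card (S - {a})"
        using card_Suc_Diff1[of S a] card_Suc_Diff1[of "S - {a}" b] True fin by blast+
      moreover have "card (insert x (insert y X)) = Suc (Suc (card X))"
        if "finite X" "y \<notin> X" "x \<notin> insert y X" for x y :: mom and X
        using that by simp
      ultimately show ?thesis using True fin by (metis finite_Diff)
    qed
    thus ?thesis using True fin bnd[of "insert (a - k) (insert (b + k) (S - {a} - {b}))"]
      by (auto simp: t_def cre_def ann_def norm_mult)
  next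
    case False
    thus ?thesis using M by (auto simp: t_def cre_def ann_def)
  qed
  define f where "f = (\<lambda>(k, a, b). of_real (Vh k) * t k a b)"
  have sm: "f summable_on UNIV \<times> S \<times> S"
  proof (rule summable_on_norm_le)
    show "(\<lambda>(k::mom, x::mom\<times>mom). Vh k * M) summable_on UNIV \<times> S \<times> S"
      by (rule summable_on_SigmaI[where g = "\<lambda>k. of_nat (card (S \<times> S)) * (Vh k * M)"])
        (use assms fin M in \<open>auto intro!: has_sum_finiteI summable_on_cmult_left summable_on_cmult_right\<close>)
  qed (use tM assms(3) in \<open>auto simp: f_def norm_mult intro!: mult_left_mono\<close>)
  \<comment> \<open>Change of variables from annihilated to created momenta:
    \<open>a = p + k\<close>, \<open>b = q - k\<close>.\<close>
  have bij: "bij_betw (\<lambda>(k, a, b). (k, a - k, b + k)) UNIV (UNIV :: (mom \<times> mom \<times> mom) set)"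
    by (rule bij_betwI[where g = "\<lambda>(k, p, q). (k, p + k, q - k)"]) auto
  have "(\<Sum>\<^sub>\<infinity>(k,p,q)\<in>UNIV. of_real (Vh k) *
        cre (madd p k) (cre (msub q k) (ann q (ann p \<Psi>))) S) = (\<Sum>\<^sub>\<infinity>x\<in>UNIV. f x)"
    by (subst infsum_reindex_bij_betw[OF bij, symmetric])
       (auto intro!: infsum_cong simp: f_def t_def madd_eq msub_eq)
  also have "\<dots> = (\<Sum>\<^sub>\<infinity>x\<in>UNIV \<times> S \<times> S. f x)"
  proof (rule infsum_cong_neutral)
    show "f x = 0" if x: "x \<in> UNIV - UNIV \<times> S \<times> S" for x
    proof -
      obtain k a b where "x = (k, a, b)" by (metis prod.exhaust)
      thus ?thesis using t0[of a b k] x by (simp add: f_def)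
    qed
  qed auto
  also have "\<dots> = (\<Sum>\<^sub>\<infinity>k. \<Sum>\<^sub>\<infinity>y\<in>S \<times> S. f (k, y))"
    by (subst infsum_Sigma'_banach) (use sm in auto)
  also have "\<dots> = (\<Sum>\<^sub>\<infinity>k. of_real (Vh k) * (rho (- k) (rho k \<Psi>) S - of_nat (card S) * \<Psi> S))"
    using fin by (simp add: rho_rho f_def t_def sum.cartesian_product sum_distrib_left case_prod_unfold)
  finally show ?thesis by (simp add: inter_def)
qed

section \<open>Lattice points near the Fermi surface\<close>

lemma msq_neg [simp]: "msq (- p) = msq p"
  by (cases p) (simp add: msq_def)

lemma msq_nonneg [simp]: "msq p \<ge> 0"
  by (cases p) (simp add: msq_def)

lemma mnorm_nonneg [simp]: "mnorm p \<ge> 0"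
  by (simp add: mnorm_def)

lemma mnorm_ge_1: "p \<noteq> 0 \<Longrightarrow> mnorm p \<ge> 1"
proof (cases p)
  case (fields a b c)
  assume "p \<noteq> 0"
  hence "a\<^sup>2 + b\<^sup>2 + c\<^sup>2 > 0"
    using fields zero_prod_def by (smt (verit) not_sum_power2_lt_zero sum_power2_gt_zero_iff zero_eq_power2 zero_less_power2)
  hence "a\<^sup>2 + b\<^sup>2 + c\<^sup>2 \<ge> 1" by simp
  hence "msq p \<ge> 1" unfolding msq_def fields by (simp del: of_int_add)
  thus ?thesis by (simp add: mnorm_def)
qed

lemma mem_fermi_ball: "kF \<ge> 0 \<Longrightarrow> p \<in> fermi_ball kF \<longleftrightarrow> msq p \<le> kF\<^sup>2"
  by (simp add: fermi_ball_def mnorm_def real_le_lsqrt sqrt_le_D real_sqrt_le_iff)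
     (metis abs_of_nonneg real_sqrt_abs real_sqrt_le_iff)

lemma fermi_ball_neg: "- p \<in> fermi_ball kF \<longleftrightarrow> p \<in> fermi_ball kF"
  by (simp add: fermi_ball_def mnorm_def)

definition int_range :: "real \<Rightarrow> int set" where
  "int_range r = {- \<lfloor>r\<rfloor>..\<lfloor>r\<rfloor>}"

lemma mem_int_range: "b \<in> int_range r \<longleftrightarrow> \<bar>real_of_int b\<bar> \<le> r"
  by (auto simp: int_range_def le_floor_iff abs_le_iff) linarith+

lemma finite_int_range [simp]: "finite (int_range r)"
  by (simp add: int_range_def)

lemma card_int_range: "r \<ge> 1 \<Longrightarrow> real (card (int_range r)) \<le> 3 * r"
  unfolding int_range_def by simp linarith

lemma msq_le_imp_coord:
  assumes "msq (a, b, c) \<le> kF\<^sup>2" "kF \<ge> 0"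
  shows "a \<in> int_range kF" "b \<in> int_range kF" "c \<in> int_range kF"
proof -
  have *: "x \<in> int_range kF" if "(real_of_int x)\<^sup>2 \<le> msq (a, b, c)" for x
  proof -
    have "(real_of_int x)\<^sup>2 \<le> kF\<^sup>2" using that assms by linarith
    thus ?thesis using assms(2) by (simp add: mem_int_range flip: abs_le_square_iff)
  qed
  show "a \<in> int_range kF" "b \<in> int_range kF" "c \<in> int_range kF"
    by (rule *, simp add: msq_def)+
qed

lemma finite_fermi_ball [simp]: "finite (fermi_ball kF)"
proof (cases "kF \<ge> 0")
  case True
  have "fermi_ball kF \<subseteq> int_range kF \<times> int_range kF \<times> int_range kF"
    using msq_le_imp_coord[OF _ True] by (auto simp: mem_fermi_ball[OF True])
  thus ?thesis by (rule finite_subset) simp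
next
  case False
  hence "fermi_ball kF = {}" unfolding fermi_ball_def using mnorm_nonneg by (smt (verit) Collect_empty_eq)
  thus ?thesis by simp
qed

section \<open>Size of the Fermi lune\<close>

definition lune :: "real \<Rightarrow> mom \<Rightarrow> mom set" where
  "lune kF k = {p. p \<notin> fermi_ball kF \<and> p - k \<in> fermi_ball kF}"

lemma finite_lune [simp]: "finite (lune kF k)"
proof -
  have "lune kF k \<subseteq> (\<lambda>p. p + k) ` fermi_ball kF"
    unfolding lune_def by (auto intro!: image_eqI[of _ _ "_ - k"])
  thus ?thesis by (rule finite_subset) simp
qed

lemma lune_0 [simp]: "lune kF 0 = {}"
  by (simp add: lune_def)

lemma card_lune_neg [simp]: "card (lune kF (- k)) = card (lune kF k)"
proof -
  have "p + k \<in> fermi_ball kF \<longleftrightarrow> - p - k \<in> fermi_ball kF" for p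
    using fermi_ball_neg[of "p + k" kF] by simp
  hence "lune kF (- k) = uminus -` lune kF k"
    by (auto simp: lune_def fermi_ball_neg)
  hence "lune kF (- k) = uminus ` lune kF k"
    by (auto intro!: image_eqI[of _ uminus "- _"])
  thus ?thesis by (simp add: card_image)
qed

text \<open>A path from \<open>p - (k + l)\<close> inside to p outside via \<open>p - l\<close>
  crosses the surface in its first or in its second step, depending on which side
  \<open>p - l\<close> lies.\<close>

lemma card_lune_add: "card (lune kF (k + l)) \<le> card (lune kF k) + card (lune kF l)"
proof -
  have "lune kF (k + l) \<subseteq> lune kF l \<union> (\<lambda>p. p + l) ` lune kF k"
  proof
    fix p assume p: "p \<in> lune kF (k + l)"
    show "p \<in> lune kF l \<union> (\<lambda>p. p + l) ` lune kF k"
    proof (cases "p - l \<in> fermi_ball kF")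
      case True thus ?thesis using p by (simp add: lune_def)
    next
      case False
      hence "p - l \<in> lune kF k" using p by (simp add: lune_def algebra_simps)
      thus ?thesis by (intro UnI2 image_eqI[of _ _ "p - l"]) auto
    qed
  qed
  hence "card (lune kF (k + l)) \<le> card (lune kF l \<union> (\<lambda>p. p + l) ` lune kF k)"
    by (intro card_mono) auto
  also have "\<dots> \<le> card (lune kF l) + card ((\<lambda>p. p + l) ` lune kF k)" by (rule card_Un_le)
  also have "\<dots> \<le> card (lune kF l) + card (lune kF k)" by (simp add: card_image_le)
  finally show ?thesis by simp
qed

text \<open>The hypotheses force (a - 1)^2 < a^2, hence a > 0, and for positive integers the
  intervals from (a - 1)^2 to a^2 are disjoint. In the application r is kF^2 and s collects the
  squares of the other two coordinates.\<close>

lemma consecutive_squares_unique: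
  fixes a a' :: int and r s :: real
  assumes "(real_of_int a - 1)\<^sup>2 + s \<le> r" "r < (real_of_int a)\<^sup>2 + s"
    and "(real_of_int a' - 1)\<^sup>2 + s \<le> r" "r < (real_of_int a')\<^sup>2 + s"
  shows "a = a'"
proof -
  have *: "\<not> x < y" if "(real_of_int x - 1)\<^sup>2 + s \<le> r" "r < (real_of_int x)\<^sup>2 + s"
      "(real_of_int y - 1)\<^sup>2 + s \<le> r" for x y
  proof
    assume "x < y"
    have "(real_of_int x - 1)\<^sup>2 < (real_of_int x)\<^sup>2" using that by linarith
    hence "real_of_int x > 0" by (simp add: power2_eq_square algebra_simps)
    moreover have "real_of_int x \<le> real_of_int y - 1" using \<open>x < y\<close> by linarith
    ultimately have "(real_of_int x)\<^sup>2 \<le> (real_of_int y - 1)\<^sup>2" by (intro power_mono) auto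
    with that show False by linarith
  qed
  from *[of a a'] *[of a' a] assms show ?thesis by simp
qed

text \<open>Here f forgets the coordinate along e. The other two take at most 3 * kF values each,
  which is the origin of the 9.\<close>

lemma card_lune_line:
  assumes "kF \<ge> 1" and "inj_on f (lune kF e)" and "f ` lune kF e \<subseteq> int_range kF \<times> int_range kF"
  shows "real (card (lune kF e)) \<le> 9 * kF\<^sup>2"
proof -
  have "card (lune kF e) \<le> card (int_range kF \<times> int_range kF)"
    by (rule card_inj_on_le[OF assms(2,3)]) simp
  hence "real (card (lune kF e)) \<le> real (card (int_range kF)) * real (card (int_range kF))"
    by (simp add: card_cartesian_product flip: of_nat_mult)
  also have "\<dots> \<le> (3 * kF) * (3 * kF)"
    by (intro mult_mono card_int_range) (use assms in auto)
  finally show ?thesis by (simp add: power2_eq_square)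
qed

text \<open>Every line parallel to a coordinate axis leaves the ball at most once in each direction.\<close>

lemma card_lune_unit:
  assumes "kF \<ge> 1" and "e \<in> {(1,0,0), (0,1,0), (0,0,1)}"
  shows "real (card (lune kF e)) \<le> 9 * kF\<^sup>2"
proof -
  have k0: "kF \<ge> 0" using assms by simp
  note M = mem_fermi_ball[OF k0]
  consider "e = (1,0,0)" | "e = (0,1,0)" | "e = (0,0,1)" using assms by auto
  thus ?thesis
  proof cases
    case 1
    show ?thesis
    proof (rule card_lune_line[where f = "\<lambda>(a,b,c). (b,c)"])
      show "inj_on (\<lambda>(a,b,c). (b,c)) (lune kF e)"
      proof (clarsimp simp: inj_on_def)
        fix a b c a' assume "(a, b, c) \<in> lune kF e" "(a', b, c) \<in> lune kF e"
        thus "a = a'" unfolding 1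
          by (intro consecutive_squares_unique[of a "(real_of_int b)\<^sup>2 + (real_of_int c)\<^sup>2" "kF\<^sup>2" a'])
            (auto simp: lune_def M msq_def algebra_simps not_le)
      qed
      \<comment> \<open>The lune point itself lies outside the ball; the range comes from
        \<open>p - e\<close>, which is inside and has the same two coordinates.\<close>
      show "(\<lambda>(a,b,c). (b,c)) ` lune kF e \<subseteq> int_range kF \<times> int_range kF"
        using msq_le_imp_coord[OF _ k0] unfolding 1 by (auto simp: lune_def M)
    qed (use assms in auto)
  next
    case 2
    show ?thesis
    proof (rule card_lune_line[where f = "\<lambda>(a,b,c). (a,c)"])
      show "inj_on (\<lambda>(a,b,c). (a,c)) (lune kF e)"
      proof (clarsimp simp: inj_on_def)
        fix a b c b' assume "(a, b, c) \<in> lune kF e" "(a, b', c) \<in> lune kF e"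
        thus "b = b'" unfolding 2
          by (intro consecutive_squares_unique[of b "(real_of_int a)\<^sup>2 + (real_of_int c)\<^sup>2" "kF\<^sup>2" b'])
            (auto simp: lune_def M msq_def algebra_simps not_le)
      qed
      show "(\<lambda>(a,b,c). (a,c)) ` lune kF e \<subseteq> int_range kF \<times> int_range kF"
        using msq_le_imp_coord[OF _ k0] unfolding 2 by (auto simp: lune_def M)
    qed (use assms in auto)
  next
    case 3
    show ?thesis
    proof (rule card_lune_line[where f = "\<lambda>(a,b,c). (a,b)"])
      show "inj_on (\<lambda>(a,b,c). (a,b)) (lune kF e)"
      proof (clarsimp simp: inj_on_def)
        fix a b c c' assume "(a, b, c) \<in> lune kF e" "(a, b, c') \<in> lune kF e"
        thus "c = c'" unfolding 3
          by (intro consecutive_squares_unique[of c "(real_of_int a)\<^sup>2 + (real_of_int b)\<^sup>2" "kF\<^sup>2" c'])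
            (auto simp: lune_def M msq_def algebra_simps not_le)
      qed
      show "(\<lambda>(a,b,c). (a,b)) ` lune kF e \<subseteq> int_range kF \<times> int_range kF"
        using msq_le_imp_coord[OF _ k0] unfolding 3 by (auto simp: lune_def M)
    qed (use assms in auto)
  qed
qed

primrec multiple :: "nat \<Rightarrow> mom \<Rightarrow> mom" where
  "multiple 0 e = 0"
| "multiple (Suc n) e = e + multiple n e"

lemma card_lune_multiple: "card (lune kF (multiple n e)) \<le> n * card (lune kF e)"
proof (induction n)
  case (Suc n)
  show ?case using card_lune_add[of kF e "multiple n e"] Suc by simp
qed (simp flip: zero_prod_def)

lemma multiple_eq: "multiple n (a, b, c) = (int n * a, int n * b, int n * c)"
  by (induction n) (auto simp: algebra_simps zero_prod_def)

lemma card_lune_axis: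
  fixes e k :: mom and m :: int
  assumes "kF \<ge> 1" and e: "e = (1,0,0) \<and> k = (m,0,0) \<or> e = (0,1,0) \<and> k = (0,m,0) \<or> e = (0,0,1) \<and> k = (0,0,m)"
  shows "real (card (lune kF k)) \<le> \<bar>real_of_int m\<bar> * (9 * kF\<^sup>2)"
proof -
  define n where "n = nat \<bar>m\<bar>"
  have "k = multiple n e \<or> k = - multiple n e"
    using e by (auto simp: multiple_eq n_def)
  hence "card (lune kF k) \<le> n * card (lune kF e)"
    using card_lune_multiple[of kF n e] by auto
  hence "real (card (lune kF k)) \<le> real n * real (card (lune kF e))"
    by (simp flip: of_nat_mult)
  also have "\<dots> \<le> real n * (9 * kF\<^sup>2)"
    by (intro mult_left_mono card_lune_unit) (use assms in auto)
  finally show ?thesis by (simp add: n_def)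
qed

lemma coord_le_mnorm:
  "\<bar>real_of_int a\<bar> \<le> mnorm (a, b, c)" "\<bar>real_of_int b\<bar> \<le> mnorm (a, b, c)" "\<bar>real_of_int c\<bar> \<le> mnorm (a, b, c)"
  unfolding mnorm_def by (rule real_le_rsqrt, simp add: msq_def)+

text \<open>A staircase path along the axes: each of the three legs has at most |k| unit steps, and
  each step costs 9 * kF^2. Linear growth in |k| is what the assumption on V can absorb.\<close>

lemma card_lune_le:
  assumes "kF \<ge> 1"
  shows "real (card (lune kF k)) \<le> 27 * kF\<^sup>2 * mnorm k"
proof (cases k)
  case (fields a b c)
  have "k = (a,0,0) + ((0,b,0) + (0,0,c))" using fields by simp
  hence "card (lune kF k) \<le> card (lune kF (a,0,0)) + (card (lune kF (0,b,0)) + card (lune kF (0,0,c)))"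
    using card_lune_add[of kF "(a,0,0)" "(0,b,0) + (0,0,c)"] card_lune_add[of kF "(0,b,0)" "(0,0,c)"] by simp
  hence "real (card (lune kF k)) \<le>
      real (card (lune kF (a,0,0))) + (real (card (lune kF (0,b,0))) + real (card (lune kF (0,0,c))))"
    by linarith
  also have "\<dots> \<le> mnorm k * (9 * kF\<^sup>2) + (mnorm k * (9 * kF\<^sup>2) + mnorm k * (9 * kF\<^sup>2))"
    unfolding fields
    by (intro add_mono order_trans[OF card_lune_axis[OF assms, of "(1,0,0)" _ a]]
       order_trans[OF card_lune_axis[OF assms, of "(0,1,0)" _ b]]
       order_trans[OF card_lune_axis[OF assms, of "(0,0,1)" _ c]] mult_right_mono coord_le_mnorm) simp_all
  finally show ?thesis by (simp add: algebra_simps)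
qed

text \<open>The gap of 1 comes from \<open>msq\<close> being integer valued.\<close>

lemma msq_gap:
  assumes "p \<in> fermi_ball kF" "q \<notin> fermi_ball kF" "kF \<ge> 0"
  shows "msq p \<le> of_int \<lfloor>kF\<^sup>2\<rfloor>" "msq q \<ge> of_int \<lfloor>kF\<^sup>2\<rfloor> + 1"
proof -
  have *: "\<exists>z. msq p = of_int z" for p
    by (cases p) (auto simp: msq_def simp del: of_int_add)
  obtain x y where xy: "msq p = of_int x" "msq q = of_int y" using * by blast
  have "of_int x \<le> kF\<^sup>2" using assms xy by (simp add: mem_fermi_ball)
  thus "msq p \<le> of_int \<lfloor>kF\<^sup>2\<rfloor>" by (simp add: xy le_floor_iff)
  have "kF\<^sup>2 < of_int y" using assms xy by (simp add: mem_fermi_ball)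
  hence "\<lfloor>kF\<^sup>2\<rfloor> < y" by (simp add: floor_less_iff)
  thus "msq q \<ge> of_int \<lfloor>kF\<^sup>2\<rfloor> + 1" unfolding xy by linarith
qed

section \<open>Density operators on square-summable states\<close>

definition slater :: "nat \<Rightarrow> mom set set" where
  "slater N = {S. finite S \<and> card S = N}"

text \<open>The indices for which c*_a c_{a+k} contributes at S. Excluding \<open>a\<close> from the
  occupied set keeps k = 0 in the same scheme: every element qualifies and \<open>hop\<close> is the
  identity.\<close>

definition hset :: "mom \<Rightarrow> mom set \<Rightarrow> mom set" where
  "hset k S = {a \<in> S. a + k \<notin> S - {a}}"

definition hop :: "mom \<Rightarrow> mom set \<Rightarrow> mom \<Rightarrow> mom set" where
  "hop k S a = insert (a + k) (S - {a})"

definition hsign :: "mom \<Rightarrow> mom set \<Rightarrow> mom \<Rightarrow> complex" where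
  "hsign k S a = fsign a (S - {a}) * fsign (a + k) (S - {a})"

definition l2 :: "nat \<Rightarrow> state \<Rightarrow> bool" where
  "l2 N \<Psi> \<longleftrightarrow> (\<lambda>S. (cmod (\<Psi> S))\<^sup>2) summable_on slater N"

definition sqnorm :: "nat \<Rightarrow> state \<Rightarrow> real" where
  "sqnorm N \<Psi> = (\<Sum>\<^sub>\<infinity>S\<in>slater N. (cmod (\<Psi> S))\<^sup>2)"

lemma finite_slater: "S \<in> slater N \<Longrightarrow> finite S"
  by (simp add: slater_def)

lemma finite_hset: "S \<in> slater N \<Longrightarrow> finite (hset k S)"
  by (simp add: slater_def hset_def)

lemma card_hset_le: "S \<in> slater N \<Longrightarrow> card (hset k S) \<le> N"
  by (auto simp: slater_def hset_def intro!: card_mono)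

lemma cmod_hsign [simp]: "cmod (hsign k S a) = 1"
  by (simp add: hsign_def norm_mult)

lemma cnj_hsign [simp]: "cnj (hsign k S a) = hsign k S a"
  by (simp add: hsign_def)

lemma rho_eq:
  assumes "finite S"
  shows "rho k \<Psi> S = (\<Sum>a\<in>hset k S. hsign k S a * \<Psi> (hop k S a))"
proof -
  have "rho k \<Psi> S = (\<Sum>a\<in>hset k S. cre a (ann (a + k) \<Psi>) S)"
    unfolding rho_def
    by (rule sum.mono_neutral_right) (use assms in \<open>auto simp: hset_def cre_def ann_def\<close>)
  also have "\<dots> = (\<Sum>a\<in>hset k S. hsign k S a * \<Psi> (hop k S a))"
    by (rule sum.cong) (auto simp: hset_def cre_def ann_def hsign_def hop_def)
  finally show ?thesis .
qed

lemma hop_in_slater: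
  assumes "S \<in> slater N" "a \<in> hset k S"
  shows "hop k S a \<in> slater N"
proof -
  have "Suc (card (S - {a})) = card S"
    using assms by (intro card_Suc_Diff1) (auto simp: slater_def hset_def)
  thus ?thesis using assms by (simp add: slater_def hset_def hop_def)
qed

lemma hop_back:
  assumes "a \<in> hset k S"
  shows "a + k \<in> hset (- k) (hop k S a)" "hop (- k) (hop k S a) (a + k) = S"
    "hsign (- k) (hop k S a) (a + k) = hsign k S a"
proof -
  have *: "hop k S a - {a + k} = S - {a}" using assms by (auto simp: hset_def hop_def)
  show "a + k \<in> hset (- k) (hop k S a)" using * by (simp add: hset_def) (simp add: hop_def)
  show "hop (- k) (hop k S a) (a + k) = S"
    using assms unfolding hop_def[of "- k"] * by (simp add: hset_def insert_absorb)
  show "hsign (- k) (hop k S a) (a + k) = hsign k S a"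
    unfolding hsign_def * by simp
qed

text \<open>The pairs (S, a) enumerate the nonzero matrix entries of \<open>rho k\<close>. Undoing a
  hop by k is a hop by -k, so transposing the matrix is a reindexing of pairs.\<close>

lemma bij_hop:
  "bij_betw (\<lambda>(S, a). (hop k S a, a + k)) (Sigma (slater N) (hset k)) (Sigma (slater N) (hset (- k)))"
proof (rule bij_betwI[where g = "\<lambda>(S, a). (hop (- k) S a, a + (- k))"])
  show "(\<lambda>(S, a). (hop k S a, a + k)) \<in> Sigma (slater N) (hset k) \<rightarrow> Sigma (slater N) (hset (- k))"
    by (auto simp: hop_in_slater hop_back)
  show "(\<lambda>(S, a). (hop (- k) S a, a + (- k))) \<in> Sigma (slater N) (hset (- k)) \<rightarrow> Sigma (slater N) (hset k)"
    using hop_back(1)[of _ "- k"] by (auto simp: hop_in_slater)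
  show "(case case x of (S, a) \<Rightarrow> (hop k S a, a + k) of (S, a) \<Rightarrow> (hop (- k) S a, a + (- k))) = x"
    if "x \<in> Sigma (slater N) (hset k)" for x
    using that by (cases x) (simp add: hop_back)
  show "(case case x of (S, a) \<Rightarrow> (hop (- k) S a, a + (- k)) of (S, a) \<Rightarrow> (hop k S a, a + k)) = x"
    if "x \<in> Sigma (slater N) (hset (- k))" for x
    using that hop_back(2)[of _ "- k"] by (cases x) simp
qed

lemma infsum_hop:
  fixes f :: "mom set \<Rightarrow> mom \<Rightarrow> complex"
  assumes "(\<lambda>(S, a). f S a) summable_on Sigma (slater N) (hset (- k))"
  shows "(\<Sum>\<^sub>\<infinity>S\<in>slater N. \<Sum>a\<in>hset k S. f (hop k S a) (a + k)) = (\<Sum>\<^sub>\<infinity>S\<in>slater N. \<Sum>a\<in>hset (- k) S. f S a)"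
proof -
  have "(\<lambda>(S, a). f (hop k S a) (a + k)) summable_on Sigma (slater N) (hset k)"
    using summable_on_reindex_bij_betw[OF bij_hop[of k N], of "\<lambda>(S, a). f S a"] assms
    by (simp add: case_prod_unfold)
  hence "(\<Sum>\<^sub>\<infinity>S\<in>slater N. \<Sum>\<^sub>\<infinity>a\<in>hset k S. f (hop k S a) (a + k))
      = (\<Sum>\<^sub>\<infinity>(S, a)\<in>Sigma (slater N) (hset k). f (hop k S a) (a + k))"
    by (rule infsum_Sigma'_banach)
  also have "\<dots> = (\<Sum>\<^sub>\<infinity>(S, a)\<in>Sigma (slater N) (hset (- k)). f S a)"
    using infsum_reindex_bij_betw[OF bij_hop[of k N], of "\<lambda>(S, a). f S a"]
    by (simp add: case_prod_unfold)
  also have "\<dots> = (\<Sum>\<^sub>\<infinity>S\<in>slater N. \<Sum>\<^sub>\<infinity>a\<in>hset (- k) S. f S a)"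
    by (rule infsum_Sigma'_banach[OF assms, symmetric])
  finally show ?thesis
    by (simp add: finite_hset cong: infsum_cong)
qed

lemma summable_on_pairs:
  fixes f :: "mom set \<Rightarrow> real"
  assumes "f summable_on slater N" "\<And>S. S \<in> slater N \<Longrightarrow> f S \<ge> 0"
  shows "(\<lambda>(S, a). f S) summable_on Sigma (slater N) (hset k)"
proof (rule summable_on_SigmaI)
  show "((\<lambda>a. case (S, a) of (S, a) \<Rightarrow> f S) has_sum real (card (hset k S)) * f S) (hset k S)"
    if "S \<in> slater N" for S
    using that by (intro has_sum_finiteI) (auto simp: finite_hset)
  show "(\<lambda>S. real (card (hset k S)) * f S) summable_on slater N"
    by (rule summable_on_norm_le[OF summable_on_cmult_right[OF assms(1), of "real N"]])
       (use assms card_hset_le[where k = k] in \<open>auto simp: abs_mult simp del: split_paired_All intro!: mult_right_mono\<close>)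
qed (use assms in auto)

text \<open>Double counting: after the hops are reversed, f S appears once for each admissible hop
  arriving at S, and c S bounds their number. The predicate P allows hops to be counted according to
  the side of the Fermi surface.\<close>

lemma hop_sum_le:
  fixes f :: "mom set \<Rightarrow> real" and P :: "mom set \<Rightarrow> mom \<Rightarrow> bool" and c :: "mom set \<Rightarrow> real"
  assumes f: "f summable_on slater N" "\<And>S. S \<in> slater N \<Longrightarrow> f S \<ge> 0"
    and cf: "(\<lambda>S. c S * f S) summable_on slater N"
    and c: "\<And>S. S \<in> slater N \<Longrightarrow> real (card {b \<in> hset (- k) S. P (hop (- k) S b) (b - k)}) \<le> c S"
  shows "(\<lambda>S. \<Sum>a\<in>{a \<in> hset k S. P S a}. f (hop k S a)) summable_on slater N" (is ?A)
    and "(\<Sum>\<^sub>\<infinity>S\<in>slater N. \<Sum>a\<in>{a \<in> hset k S. P S a}. f (hop k S a)) \<le> (\<Sum>\<^sub>\<infinity>S\<in>slater N. c S * f S)" (is ?B)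
proof -
  define g where "g = (\<lambda>(S, b). if P (hop (- k) S b) (b - k) then f S else 0)"
  define h where "h = (\<lambda>(S, a). if P S a then f (hop k S a) else 0)"
  have gs: "g summable_on Sigma (slater N) (hset (- k))"
    by (rule summable_on_norm_le[OF summable_on_pairs[OF f, of "- k"]]) (use f in \<open>auto simp: g_def\<close>)
  have gh: "g (case x of (S, a) \<Rightarrow> (hop k S a, a + k)) = h x" if "x \<in> Sigma (slater N) (hset k)" for x
    using that by (cases x) (simp add: g_def h_def hop_back)
  have hs: "h summable_on Sigma (slater N) (hset k)"
    using gs summable_on_reindex_bij_betw[OF bij_hop[of k N], of g] gh
    by (simp cong: summable_on_cong)
  have hsum: "(\<Sum>\<^sub>\<infinity>a\<in>hset k S. h (S, a)) = (\<Sum>a\<in>{a \<in> hset k S. P S a}. f (hop k S a))"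
    if "S \<in> slater N" for S
    using that by (simp add: finite_hset h_def sum.If_cases Int_def)
  have gsum: "(\<Sum>\<^sub>\<infinity>b\<in>hset (- k) S. g (S, b)) = real (card {b \<in> hset (- k) S. P (hop (- k) S b) (b - k)}) * f S"
    if "S \<in> slater N" for S
    using that by (simp add: finite_hset g_def sum.If_cases Int_def)
  have hs': "(\<lambda>(S, a). h (S, a)) summable_on Sigma (slater N) (hset k)"
    and gs': "(\<lambda>(S, a). g (S, a)) summable_on Sigma (slater N) (hset (- k))"
    using hs gs by simp_all
  show ?A using summable_on_Sigma_banach[OF hs'] hsum by (simp cong: summable_on_cong)
  have "(\<Sum>\<^sub>\<infinity>S\<in>slater N. \<Sum>a\<in>{a \<in> hset k S. P S a}. f (hop k S a)) = infsum h (Sigma (slater N) (hset k))"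
    using infsum_Sigma'_banach[OF hs'] hsum by (simp cong: infsum_cong)
  also have "\<dots> = infsum g (Sigma (slater N) (hset (- k)))"
    using infsum_reindex_bij_betw[OF bij_hop[of k N], of g] gh by (simp cong: infsum_cong)
  also have "\<dots> = (\<Sum>\<^sub>\<infinity>S\<in>slater N. real (card {b \<in> hset (- k) S. P (hop (- k) S b) (b - k)}) * f S)"
    using infsum_Sigma'_banach[OF gs'] gsum by (simp cong: infsum_cong)
  also have "\<dots> \<le> (\<Sum>\<^sub>\<infinity>S\<in>slater N. c S * f S)"
    using summable_on_Sigma_banach[OF gs'] gsum f(2) c cf
    by (intro infsum_mono mult_right_mono) (simp_all cong: summable_on_cong)
  finally show ?B .
qed

lemma sum_squared_le:
  fixes x :: "'a \<Rightarrow> real"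
  assumes "\<And>a. a \<in> A \<Longrightarrow> cmod (y a) \<le> x a"
  shows "(cmod (sum y A))\<^sup>2 \<le> real (card A) * (\<Sum>a\<in>A. (x a)\<^sup>2)"
proof -
  have "cmod (sum y A) \<le> (\<Sum>a\<in>A. 1 * x a)"
    using assms by (simp add: sum_norm_le)
  hence "(cmod (sum y A))\<^sup>2 \<le> (\<Sum>a\<in>A. 1 * x a)\<^sup>2" by (intro power_mono) auto
  also have "\<dots> \<le> (\<Sum>a\<in>A. 1\<^sup>2) * (\<Sum>a\<in>A. (x a)\<^sup>2)" by (rule Cauchy_Schwarz_ineq_sum)
  finally show ?thesis by simp
qed

text \<open>One factor N comes from Cauchy-Schwarz over at most N hops leaving S, the other from at
  most N hops arriving. The bound is used for convergence only; no estimate below keeps N in its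
  constant.\<close>

lemma l2_rho:
  assumes "l2 N \<Psi>"
  shows "l2 N (rho k \<Psi>)" "sqnorm N (rho k \<Psi>) \<le> (real N)\<^sup>2 * sqnorm N \<Psi>"
proof -
  define f where "f S = (cmod (\<Psi> S))\<^sup>2" for S
  have f: "f summable_on slater N" using assms unfolding l2_def f_def .
  have Nf: "(\<lambda>S. real N * f S) summable_on slater N" by (rule summable_on_cmult_right[OF f])
  note H = hop_sum_le[OF f _ Nf, of k "\<lambda>_ _. True"]
  have H1: "(\<lambda>S. \<Sum>a\<in>hset k S. f (hop k S a)) summable_on slater N"
    and H2: "(\<Sum>\<^sub>\<infinity>S\<in>slater N. \<Sum>a\<in>hset k S. f (hop k S a)) \<le> (\<Sum>\<^sub>\<infinity>S\<in>slater N. real N * f S)"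
    using H card_hset_le by (simp_all add: f_def)
  have le: "(cmod (rho k \<Psi> S))\<^sup>2 \<le> real N * (\<Sum>a\<in>hset k S. f (hop k S a))" if "S \<in> slater N" for S
  proof -
    have "(cmod (rho k \<Psi> S))\<^sup>2 \<le> real (card (hset k S)) * (\<Sum>a\<in>hset k S. f (hop k S a))"
      unfolding rho_eq[OF finite_slater[OF that]] f_def by (rule sum_squared_le) (simp add: norm_mult)
    also have "\<dots> \<le> real N * (\<Sum>a\<in>hset k S. f (hop k S a))"
      using card_hset_le[OF that] by (intro mult_right_mono sum_nonneg) (auto simp: f_def)
    finally show ?thesis .
  qed
  have s: "(\<lambda>S. (cmod (rho k \<Psi> S))\<^sup>2) summable_on slater N"
    by (rule summable_on_norm_le[OF summable_on_cmult_right[OF H1, of "real N"]]) (use le in auto)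
  thus "l2 N (rho k \<Psi>)" by (simp add: l2_def)
  have "sqnorm N (rho k \<Psi>) \<le> (\<Sum>\<^sub>\<infinity>S\<in>slater N. real N * (\<Sum>a\<in>hset k S. f (hop k S a)))"
    unfolding sqnorm_def by (rule infsum_mono[OF s summable_on_cmult_right[OF H1] le])
  also have "\<dots> = real N * (\<Sum>\<^sub>\<infinity>S\<in>slater N. (\<Sum>a\<in>hset k S. f (hop k S a)))"
    by (rule infsum_cmult_right')
  also have "\<dots> \<le> real N * (real N * sqnorm N \<Psi>)"
    using H2 by (intro mult_left_mono) (simp_all add: infsum_cmult_right' sqnorm_def f_def)
  finally show "sqnorm N (rho k \<Psi>) \<le> (real N)\<^sup>2 * sqnorm N \<Psi>" by (simp add: power2_eq_square)
qed

lemma mult_le_sum_squares: "x * y \<le> x\<^sup>2 + (y::real)\<^sup>2"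
  using sum_squares_bound[of x y] zero_le_power2[of x] zero_le_power2[of y] by linarith

text \<open>The hop signs are real and unchanged under reversal, so reversing all hops moves
  \<open>rho (- k)\<close> to the other side as \<open>rho k\<close>.\<close>

lemma rho_adjoint:
  assumes \<Phi>: "l2 N \<Phi>" and X: "l2 N X"
  shows "(\<Sum>\<^sub>\<infinity>S\<in>slater N. cnj (\<Phi> S) * rho (- k) X S) = (\<Sum>\<^sub>\<infinity>S\<in>slater N. cnj (rho k \<Phi> S) * X S)"
proof -
  define f where "f S a = cnj (\<Phi> S) * (hsign (- k) S a * X (hop (- k) S a))" for S a
  have "(\<lambda>(S, a). f S a) summable_on Sigma (slater N) (hset (- k))"
  proof (rule summable_on_norm_le)
    have 1: "(\<lambda>(S, a). (cmod (\<Phi> S))\<^sup>2) summable_on Sigma (slater N) (hset (- k))"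
      using \<Phi> by (intro summable_on_pairs) (auto simp: l2_def)
    have "(\<lambda>(S, a). (cmod (X S))\<^sup>2) summable_on Sigma (slater N) (hset (- (- k)))"
      using X by (intro summable_on_pairs) (auto simp: l2_def)
    hence 2: "(\<lambda>(S, a). (cmod (X (hop (- k) S a)))\<^sup>2) summable_on Sigma (slater N) (hset (- k))"
      using summable_on_reindex_bij_betw[OF bij_hop[of "- k" N], of "\<lambda>(S, a). (cmod (X S))\<^sup>2"]
      by (simp add: case_prod_unfold)
    show "(\<lambda>x. (case x of (S, a) \<Rightarrow> (cmod (\<Phi> S))\<^sup>2) + (case x of (S, a) \<Rightarrow> (cmod (X (hop (- k) S a)))\<^sup>2))
       summable_on Sigma (slater N) (hset (- k))"
      by (rule summable_on_add[OF 1 2])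
  qed (auto simp: f_def norm_mult intro: mult_le_sum_squares)
  from infsum_hop[OF this]
  have "(\<Sum>\<^sub>\<infinity>S\<in>slater N. \<Sum>a\<in>hset k S. hsign k S a * cnj (\<Phi> (hop k S a)) * X S)
      = (\<Sum>\<^sub>\<infinity>S\<in>slater N. \<Sum>a\<in>hset (- k) S. f S a)"
    by (simp add: f_def hop_back mult_ac cong: infsum_cong sum.cong)
  thus ?thesis
    by (simp add: rho_eq finite_slater f_def sum_distrib_left sum_distrib_right mult_ac cong: infsum_cong)
qed

section \<open>Commutator with the excitation number\<close>

definition nexc :: "real \<Rightarrow> mom set \<Rightarrow> nat" where
  "nexc kF S = card (S - fermi_ball kF)"

definition nexp :: "real \<Rightarrow> nat \<Rightarrow> state \<Rightarrow> real" where
  "nexp kF N \<Psi> = (\<Sum>\<^sub>\<infinity>S\<in>slater N. real (nexc kF S) * (cmod (\<Psi> S))\<^sup>2)"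

definition nmult :: "real \<Rightarrow> state \<Rightarrow> state" where
  "nmult kF \<Psi> S = of_nat (nexc kF S) * \<Psi> S"

definition rho_comm :: "real \<Rightarrow> mom \<Rightarrow> state \<Rightarrow> state" where
  "rho_comm kF k \<Psi> S = rho k (nmult kF \<Psi>) S - of_nat (nexc kF S) * rho k \<Psi> S"

lemma nexc_le: "S \<in> slater N \<Longrightarrow> nexc kF S \<le> N"
  by (auto simp: slater_def nexc_def intro!: card_mono)

lemma nexc_insert:
  assumes "finite R" "x \<notin> R"
  shows "nexc kF (insert x R) = nexc kF R + (if x \<in> fermi_ball kF then 0 else 1)"
  using assms by (simp add: nexc_def insert_Diff_if)

text \<open>Stated as a balance of sums because \<open>nexc\<close> is a natural number.\<close>

lemma nexc_hop:
  assumes "S \<in> slater N" "a \<in> hset k S"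
  shows "nexc kF (hop k S a) + (if a \<in> fermi_ball kF then 0 else 1)
       = nexc kF S + (if a + k \<in> fermi_ball kF then 0 else 1)"
proof -
  have "S = insert a (S - {a})" using assms by (auto simp: hset_def)
  hence "nexc kF S = nexc kF (S - {a}) + (if a \<in> fermi_ball kF then 0 else 1)"
    using nexc_insert[of "S - {a}" a kF] finite_slater[OF assms(1)] by simp
  moreover have "nexc kF (hop k S a) = nexc kF (S - {a}) + (if a + k \<in> fermi_ball kF then 0 else 1)"
    unfolding hop_def using assms finite_slater[OF assms(1)] by (intro nexc_insert) (auto simp: hset_def)
  ultimately show ?thesis by simp
qed

lemma l2_mult_bounded:
  assumes "l2 N \<Psi>" "\<And>S. S \<in> slater N \<Longrightarrow> cmod (w S) \<le> B"
  shows "l2 N (\<lambda>S. w S * \<Psi> S)"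
  unfolding l2_def
  by (rule summable_on_norm_le[OF summable_on_cmult_right[OF assms(1)[unfolded l2_def], of "B\<^sup>2"]])
     (use assms(2) in \<open>auto simp: norm_mult power_mult_distrib intro!: mult_right_mono power_mono\<close>)

lemma l2_nmult: "l2 N \<Psi> \<Longrightarrow> l2 N (nmult kF \<Psi>)"
  unfolding nmult_def [abs_def] by (rule l2_mult_bounded[where B = "real N"]) (auto simp: nexc_le)

lemma nexp_summable:
  assumes "l2 N \<Psi>"
  shows "(\<lambda>S. real (nexc kF S) * (cmod (\<Psi> S))\<^sup>2) summable_on slater N"
  by (rule summable_on_norm_le[OF summable_on_cmult_right[OF assms[unfolded l2_def], of "real N"]])
     (auto simp: nexc_le intro!: mult_right_mono)

lemma rho_comm_eq:
  assumes "S \<in> slater N"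
  shows "rho_comm kF k \<Psi> S = (\<Sum>a\<in>hset k S. hsign k S a *
     ((of_nat (nexc kF (hop k S a)) - of_nat (nexc kF S)) * \<Psi> (hop k S a)))"
  unfolding rho_comm_def rho_eq[OF finite_slater[OF assms]] nmult_def
  by (simp add: sum_distrib_left algebra_simps flip: sum_subtractf)

text \<open>For each direction across the surface, Cauchy-Schwarz counts hops leaving S and
  \<open>hop_sum_le\<close> counts hops arriving. One of the two counts is bounded by the lune, the
  other by the number of excitations, so the lune enters only once. Which count is which depends on
  the direction.\<close>

lemma sqnorm_rho_comm_le:
  assumes "l2 N \<Psi>"
  shows "l2 N (rho_comm kF k \<Psi>)"
    and "sqnorm N (rho_comm kF k \<Psi>) \<le> 2 * real (card (lune kF k)) * (2 * nexp kF N \<Psi> + sqnorm N \<Psi>)"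
proof -
  define L where "L = real (card (lune kF k))"
  define f where "f S = (cmod (\<Psi> S))\<^sup>2" for S
  have f: "f summable_on slater N" using assms unfolding l2_def f_def .
  have nf: "(\<lambda>S. real (nexc kF S) * f S) summable_on slater N"
    unfolding f_def by (rule nexp_summable[OF assms])
  \<comment> \<open>The extra f pays for the direction in which \<open>nexc\<close> is one larger at
    S than at the set reached by the hop.\<close>
  define f' where "f' S = real (nexc kF S) * f S + f S" for S
  have f': "f' summable_on slater N" unfolding f'_def by (rule summable_on_add[OF nf f])
  define P where "P = (\<lambda>(S :: mom set) a. a \<in> fermi_ball kF \<and> a + k \<notin> fermi_ball kF)"
  define R where "R = (\<lambda>(S :: mom set) a. a \<notin> fermi_ball kF \<and> a + k \<in> fermi_ball kF)"
  define X where "X S = (\<Sum>a\<in>{a \<in> hset k S. P S a}. f (hop k S a))" for S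
  define Y where "Y S = (\<Sum>a\<in>{a \<in> hset k S. R S a}. f' (hop k S a))" for S
  \<comment> \<open>Such a \<open>b\<close> lies in S and outside the ball, so these arrivals are
    counted by the excitations of S.\<close>
  have cP: "real (card {b \<in> hset (- k) S. P (hop (- k) S b) (b - k)}) \<le> real (nexc kF S)" if "S \<in> slater N" for S
    using finite_slater[OF that] by (auto simp: nexc_def hset_def P_def intro!: card_mono)
  have X: "X summable_on slater N" "infsum X (slater N) \<le> nexp kF N \<Psi>"
    using hop_sum_le[OF f _ nf cP] by (simp_all add: X_def [abs_def] nexp_def) (simp_all add: f_def)
  have Lf': "(\<lambda>S. L * f' S) summable_on slater N" by (rule summable_on_cmult_right[OF f'])
  have cR: "real (card {b \<in> hset (- k) S. R (hop (- k) S b) (b - k)}) \<le> L" if "S \<in> slater N" for S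
  proof -
    have "card {b \<in> hset (- k) S. R (hop (- k) S b) (b - k)} = card ((\<lambda>b. b - k) ` {b \<in> hset (- k) S. R (hop (- k) S b) (b - k)})"
      by (rule card_image[symmetric]) (auto intro!: inj_onI)
    also have "\<dots> \<le> card (lune kF (- k))"
      by (rule card_mono[OF finite_lune]) (auto simp: R_def lune_def)
    finally show ?thesis by (simp add: L_def)
  qed
  have Y: "Y summable_on slater N" "infsum Y (slater N) \<le> (\<Sum>\<^sub>\<infinity>S\<in>slater N. L * f' S)"
    using hop_sum_le[OF f' _ Lf' cR] by (simp_all add: Y_def [abs_def]) (simp_all add: f_def f'_def)
  have le: "(cmod (rho_comm kF k \<Psi> S))\<^sup>2 \<le> 2 * L * X S + 2 * Y S" if S: "S \<in> slater N" for S
  proof -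
    define t where "t a = hsign k S a * ((of_nat (nexc kF (hop k S a)) - of_nat (nexc kF S)) * \<Psi> (hop k S a))" for a
    define A1 where "A1 = {a \<in> hset k S. P S a}"
    define A2 where "A2 = {a \<in> hset k S. R S a}"
    have fin: "finite A1" "finite A2" using finite_hset[OF S] by (simp_all add: A1_def A2_def)
    \<comment> \<open>A hop that stays on one side of the surface does not change
      \<open>nexc\<close>, so its coefficient vanishes.\<close>
    have t0: "t a = 0" if "a \<in> hset k S - (A1 \<union> A2)" for a
      using nexc_hop[OF S, of a k kF] that by (auto simp: t_def A1_def A2_def P_def R_def split: if_splits)
    have t1: "cmod (t a) = sqrt (f (hop k S a))" if "a \<in> A1 \<union> A2" for a
    proof -
      have a: "a \<in> hset k S" using that by (auto simp: A1_def A2_def)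
      have "cmod (of_nat (nexc kF (hop k S a)) - of_nat (nexc kF S)) = 1"
      proof (cases "a \<in> A1")
        case True
        hence "nexc kF (hop k S a) = nexc kF S + 1"
          using nexc_hop[OF S a, of kF] by (simp add: A1_def P_def)
        thus ?thesis by simp
      next
        case False
        hence "nexc kF S = nexc kF (hop k S a) + 1"
          using nexc_hop[OF S a, of kF] that by (simp add: A2_def R_def)
        thus ?thesis by simp
      qed
      thus ?thesis by (simp add: t_def norm_mult f_def)
    qed
    have "rho_comm kF k \<Psi> S = (\<Sum>a\<in>hset k S. t a)"
      unfolding rho_comm_eq[OF S] t_def ..
    also have "\<dots> = (\<Sum>a\<in>A1 \<union> A2. t a)"
      by (rule sum.mono_neutral_right) (use t0 finite_hset[OF S] in \<open>auto simp: A1_def A2_def\<close>)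
    also have "\<dots> = sum t A1 + sum t A2"
      using fin by (intro sum.union_disjoint) (auto simp: A1_def A2_def P_def R_def)
    finally have "cmod (rho_comm kF k \<Psi> S) \<le> cmod (sum t A1) + cmod (sum t A2)"
      by (simp add: norm_triangle_ineq)
    hence "(cmod (rho_comm kF k \<Psi> S))\<^sup>2 \<le> (cmod (sum t A1) + cmod (sum t A2))\<^sup>2"
      by (rule power_mono) simp
    also have "\<dots> \<le> 2 * (cmod (sum t A1))\<^sup>2 + 2 * (cmod (sum t A2))\<^sup>2"
      using sum_squares_bound[of "cmod (sum t A1)" "cmod (sum t A2)"] by (simp add: power2_sum)
    also have "(cmod (sum t A1))\<^sup>2 \<le> L * X S"
    proof -
      have "(cmod (sum t A1))\<^sup>2 \<le> real (card A1) * (\<Sum>a\<in>A1. (sqrt (f (hop k S a)))\<^sup>2)"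
        by (rule sum_squared_le) (simp add: t1)
      also have "\<dots> = real (card A1) * X S"
        by (simp add: f_def X_def A1_def)
      also have "card A1 = card ((\<lambda>a. a + k) ` A1)" by (simp add: card_image)
      also have "\<dots> \<le> card (lune kF k)"
        by (rule card_mono[OF finite_lune]) (auto simp: A1_def P_def lune_def)
      finally show ?thesis by (simp add: L_def X_def f_def mult_right_mono sum_nonneg)
    qed
    also have "(cmod (sum t A2))\<^sup>2 \<le> Y S"
    proof -
      have "(cmod (sum t A2))\<^sup>2 \<le> real (card A2) * (\<Sum>a\<in>A2. (sqrt (f (hop k S a)))\<^sup>2)"
        by (rule sum_squared_le) (simp add: t1)
      also have "\<dots> \<le> real (nexc kF S) * (\<Sum>a\<in>A2. (sqrt (f (hop k S a)))\<^sup>2)"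
        using finite_slater[OF S]
        by (intro mult_right_mono sum_nonneg) (auto simp: A2_def R_def nexc_def hset_def intro!: card_mono)
      also have "\<dots> = Y S"
        unfolding sum_distrib_left Y_def A2_def
      proof (rule sum.cong[OF refl])
        fix a assume "a \<in> {a \<in> hset k S. R S a}"
        hence "nexc kF S = nexc kF (hop k S a) + 1"
          using nexc_hop[OF S, of a k kF] by (simp add: R_def)
        thus "real (nexc kF S) * (sqrt (f (hop k S a)))\<^sup>2 = f' (hop k S a)"
          by (simp add: f'_def f_def algebra_simps)
      qed
      finally show ?thesis .
    qed
    finally show ?thesis by simp
  qed
  have XY: "(\<lambda>S. 2 * L * X S + 2 * Y S) summable_on slater N"
    by (intro summable_on_add summable_on_cmult_right X Y)
  have s: "(\<lambda>S. (cmod (rho_comm kF k \<Psi> S))\<^sup>2) summable_on slater N"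
    by (rule summable_on_norm_le[OF XY]) (use le in simp)
  thus "l2 N (rho_comm kF k \<Psi>)" by (simp add: l2_def)
  have "sqnorm N (rho_comm kF k \<Psi>) \<le> (\<Sum>\<^sub>\<infinity>S\<in>slater N. 2 * L * X S + 2 * Y S)"
    unfolding sqnorm_def by (rule infsum_mono[OF s XY le])
  also have "\<dots> = 2 * L * infsum X (slater N) + 2 * infsum Y (slater N)"
    by (simp add: infsum_add summable_on_cmult_right X Y infsum_cmult_right' del: mult.assoc)
  also have "\<dots> \<le> 2 * L * nexp kF N \<Psi> + 2 * (L * (nexp kF N \<Psi> + sqnorm N \<Psi>))"
  proof (intro add_mono mult_left_mono X)
    have "(\<Sum>\<^sub>\<infinity>S\<in>slater N. L * f' S) = L * (nexp kF N \<Psi> + sqnorm N \<Psi>)"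
      unfolding infsum_cmult_right' f'_def infsum_add[OF nf f] by (simp add: nexp_def sqnorm_def f_def [abs_def])
    thus "infsum Y (slater N) \<le> L * (nexp kF N \<Psi> + sqnorm N \<Psi>)" using Y(2) by simp
  qed (auto simp: L_def)
  finally show "sqnorm N (rho_comm kF k \<Psi>) \<le> 2 * real (card (lune kF k)) * (2 * nexp kF N \<Psi> + sqnorm N \<Psi>)"
    by (simp add: L_def algebra_simps)
qed

lemma sqnorm_nonneg: "sqnorm N \<Psi> \<ge> 0"
  unfolding sqnorm_def by (rule infsum_nonneg) simp

lemma nexp_nonneg: "nexp kF N \<Psi> \<ge> 0"
  unfolding nexp_def by (rule infsum_nonneg) simp

section \<open>Quadratic form of the interaction\<close>

definition form :: "nat \<Rightarrow> state \<Rightarrow> state \<Rightarrow> complex" where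
  "form N \<Phi> \<Psi> = (\<Sum>\<^sub>\<infinity>S\<in>slater N. cnj (\<Phi> S) * \<Psi> S)"

lemma form_summable:
  assumes "l2 N \<Phi>" "l2 N \<Psi>"
  shows "(\<lambda>S. cnj (\<Phi> S) * \<Psi> S) summable_on slater N"
  by (rule summable_on_norm_le[OF summable_on_add[OF assms[unfolded l2_def]]])
     (simp add: norm_mult mult_le_sum_squares)

lemma cnj_mult_self: "cnj z * z = complex_of_real ((cmod z)\<^sup>2)"
  by (metis complex_norm_square mult.commute of_real_power)

lemma form_same:
  assumes "l2 N \<Psi>"
  shows "form N \<Psi> \<Psi> = of_real (sqnorm N \<Psi>)"
proof -
  have "((\<lambda>S. complex_of_real ((cmod (\<Psi> S))\<^sup>2)) has_sum of_real (sqnorm N \<Psi>)) (slater N)"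
    unfolding sqnorm_def by (intro has_sum_of_real has_sum_infsum assms[unfolded l2_def])
  thus ?thesis
    unfolding form_def cnj_mult_self by (rule infsumI)
qed

lemma has_sum_diff:
  fixes f g :: "'a \<Rightarrow> complex"
  assumes "(f has_sum a) A" "(g has_sum b) A"
  shows "((\<lambda>x. f x - g x) has_sum (a - b)) A"
  using has_sum_add[OF assms(1) has_sum_cmult_right[OF assms(2), of "- 1"]] by simp

text \<open>The point is the exchange of the sums over k and S. The squared norm of
  \<open>rho (- k) (rho k \<Psi>)\<close> is at most N^4 times that of \<Psi>, uniformly in k, so
  the summability of V dominates the double sum. The two vectors are kept distinct because \<Phi>
  will be a weighted copy of \<Psi>.\<close>

lemma inter_form:
  assumes V: "Vh summable_on UNIV" "\<And>k. Vh k \<ge> 0" and \<Phi>: "l2 N \<Phi>" and \<Psi>: "l2 N \<Psi>"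
  shows "(\<lambda>k. of_real (Vh k) * (form N (rho k \<Phi>) (rho k \<Psi>) - of_nat N * form N \<Phi> \<Psi>)) summable_on UNIV"
    and "form N \<Phi> (inter Vh \<Psi>) = of_real (1 / (2 * (2 * pi) ^ 3)) *
       (\<Sum>\<^sub>\<infinity>k. of_real (Vh k) * (form N (rho k \<Phi>) (rho k \<Psi>) - of_nat N * form N \<Phi> \<Psi>))"
proof -
  define c :: complex where "c = of_real (1 / (2 * (2 * pi) ^ 3))"
  define u where "u k S = cnj (\<Phi> S) * (rho (- k) (rho k \<Psi>) S - of_nat N * \<Psi> S)" for k S
  define b where "b k S = (1 + real N) * (cmod (\<Phi> S))\<^sup>2 + (cmod (rho (- k) (rho k \<Psi>) S))\<^sup>2
      + real N * (cmod (\<Psi> S))\<^sup>2" for k S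
  define B where "B = (1 + real N) * sqnorm N \<Phi> + (real N)\<^sup>2 * ((real N)\<^sup>2 * sqnorm N \<Psi>) + real N * sqnorm N \<Psi>"
  have ub: "cmod (u k S) \<le> b k S" for k S
  proof -
    have "cmod (u k S) \<le> cmod (\<Phi> S) * (cmod (rho (- k) (rho k \<Psi>) S) + real N * cmod (\<Psi> S))"
      unfolding u_def norm_mult
      by (intro mult_mono order_trans[OF norm_triangle_ineq4]) (auto simp: norm_mult)
    also have "\<dots> = cmod (\<Phi> S) * cmod (rho (- k) (rho k \<Psi>) S) + real N * (cmod (\<Phi> S) * cmod (\<Psi> S))"
      by (simp add: algebra_simps)
    also have "\<dots> \<le> ((cmod (\<Phi> S))\<^sup>2 + (cmod (rho (- k) (rho k \<Psi>) S))\<^sup>2)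
        + real N * ((cmod (\<Phi> S))\<^sup>2 + (cmod (\<Psi> S))\<^sup>2)"
      by (intro add_mono mult_left_mono mult_le_sum_squares) simp
    also have "\<dots> = b k S" by (simp add: b_def algebra_simps)
    finally show ?thesis .
  qed
  have rr: "l2 N (rho (- k) (rho k \<Psi>))" for k
    by (intro l2_rho \<Psi>)
  have rrle: "sqnorm N (rho (- k) (rho k \<Psi>)) \<le> (real N)\<^sup>2 * ((real N)\<^sup>2 * sqnorm N \<Psi>)" for k
    by (rule order_trans[OF l2_rho(2)[OF l2_rho(1)[OF \<Psi>]]]) (intro mult_left_mono l2_rho(2) \<Psi>, simp)
  have bs: "((\<lambda>S. b k S) has_sum ((1 + real N) * sqnorm N \<Phi> + sqnorm N (rho (- k) (rho k \<Psi>)) + real N * sqnorm N \<Psi>)) (slater N)" for k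
    unfolding b_def sqnorm_def
    by (intro has_sum_add has_sum_cmult_right has_sum_infsum)
       (use \<Phi> \<Psi> rr[of k] in \<open>simp_all add: l2_def\<close>)
  have "(\<lambda>(k, S). Vh k * b k S) summable_on UNIV \<times> slater N"
  proof (rule summable_on_SigmaI)
    show "((\<lambda>S. case (k, S) of (k, S) \<Rightarrow> Vh k * b k S) has_sum
       Vh k * ((1 + real N) * sqnorm N \<Phi> + sqnorm N (rho (- k) (rho k \<Psi>)) + real N * sqnorm N \<Psi>)) (slater N)" for k
      using has_sum_cmult_right[OF bs] by simp
    show "(\<lambda>k. Vh k * ((1 + real N) * sqnorm N \<Phi> + sqnorm N (rho (- k) (rho k \<Psi>)) + real N * sqnorm N \<Psi>)) summable_on UNIV"
    proof (rule summable_on_norm_le[OF summable_on_cmult_left[OF V(1), of B]])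
      fix k
      have "0 \<le> (1 + real N) * sqnorm N \<Phi> + sqnorm N (rho (- k) (rho k \<Psi>)) + real N * sqnorm N \<Psi>"
        by (intro add_nonneg_nonneg mult_nonneg_nonneg sqnorm_nonneg) auto
      moreover have "(1 + real N) * sqnorm N \<Phi> + sqnorm N (rho (- k) (rho k \<Psi>)) + real N * sqnorm N \<Psi> \<le> B"
        unfolding B_def using rrle[of k] by simp
      ultimately show "norm (Vh k * ((1 + real N) * sqnorm N \<Phi> + sqnorm N (rho (- k) (rho k \<Psi>)) + real N * sqnorm N \<Psi>)) \<le> Vh k * B"
        using V(2)[of k] by (simp add: abs_mult mult_left_mono)
    qed
    show "0 \<le> (case (k, S) of (k, S) \<Rightarrow> Vh k * b k S)" for k S
      using V(2)[of k] order_trans[OF norm_ge_zero ub] by simp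
  qed
  hence vs: "(\<lambda>(k, S). of_real (Vh k) * u k S) summable_on UNIV \<times> slater N"
    by (rule summable_on_norm_le) (use ub V(2) in \<open>auto simp: norm_mult simp del: split_paired_All intro!: mult_left_mono\<close>)
  have ip: "(\<Sum>\<^sub>\<infinity>S\<in>slater N. of_real (Vh k) * u k S) = of_real (Vh k) * (form N (rho k \<Phi>) (rho k \<Psi>) - of_nat N * form N \<Phi> \<Psi>)" for k
  proof -
    have "((\<lambda>S. cnj (\<Phi> S) * rho (- k) (rho k \<Psi>) S - of_nat N * (cnj (\<Phi> S) * \<Psi> S)) has_sum
       (form N \<Phi> (rho (- k) (rho k \<Psi>)) - of_nat N * form N \<Phi> \<Psi>)) (slater N)"
      unfolding form_def
      by (intro has_sum_diff has_sum_cmult_right has_sum_infsum form_summable \<Phi> \<Psi> rr)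
    hence "((\<lambda>S. u k S) has_sum (form N (rho k \<Phi>) (rho k \<Psi>) - of_nat N * form N \<Phi> \<Psi>)) (slater N)"
      using rho_adjoint[OF \<Phi> l2_rho(1)[OF \<Psi>], of k k]
      by (simp add: u_def form_def algebra_simps)
    thus ?thesis by (intro infsumI has_sum_cmult_right)
  qed
  show "(\<lambda>k. of_real (Vh k) * (form N (rho k \<Phi>) (rho k \<Psi>) - of_nat N * form N \<Phi> \<Psi>)) summable_on UNIV"
    using summable_on_Sigma_banach[OF vs] by (simp add: ip)
  have inter: "inter Vh \<Psi> S = c * (\<Sum>\<^sub>\<infinity>k. of_real (Vh k) * (rho (- k) (rho k \<Psi>) S - of_nat N * \<Psi> S))"
    if S: "S \<in> slater N" for S
  proof -
    \<comment> \<open>The uniform coefficient bound needed for \<open>inter_eq\<close>, from x \<le>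
      x^2 + 1.\<close>
    have "cmod (\<Psi> S') \<le> 1 + sqnorm N \<Psi>" if "finite S'" "card S' = card S" for S'
    proof -
      have "S' \<in> slater N" using that S by (simp add: slater_def)
      hence "(cmod (\<Psi> S'))\<^sup>2 \<le> sqnorm N \<Psi>"
        unfolding sqnorm_def using finite_sum_le_infsum[OF \<Psi>[unfolded l2_def], of "{S'}"] by simp
      thus ?thesis using mult_le_sum_squares[of "cmod (\<Psi> S')" 1] 
        by simp
    qed
    from inter_eq[OF finite_slater[OF S] V this] show ?thesis
      using S by (simp add: slater_def c_def)
  qed
  have "form N \<Phi> (inter Vh \<Psi>) = (\<Sum>\<^sub>\<infinity>S\<in>slater N. c * (\<Sum>\<^sub>\<infinity>k. of_real (Vh k) * u k S))"
    unfolding form_def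
  proof (rule infsum_cong)
    fix S assume S: "S \<in> slater N"
    have "(\<Sum>\<^sub>\<infinity>k. of_real (Vh k) * u k S) = (\<Sum>\<^sub>\<infinity>k. cnj (\<Phi> S) * (of_real (Vh k) * (rho (- k) (rho k \<Psi>) S - of_nat N * \<Psi> S)))"
      by (simp add: u_def algebra_simps)
    thus "cnj (\<Phi> S) * inter Vh \<Psi> S = c * (\<Sum>\<^sub>\<infinity>k. of_real (Vh k) * u k S)"
      unfolding inter[OF S] by (simp only: infsum_cmult_right') (simp add: mult_ac)
  qed
  also have "\<dots> = c * (\<Sum>\<^sub>\<infinity>S\<in>slater N. \<Sum>\<^sub>\<infinity>k. of_real (Vh k) * u k S)"
    by (rule infsum_cmult_right')
  also have "(\<Sum>\<^sub>\<infinity>S\<in>slater N. \<Sum>\<^sub>\<infinity>k. of_real (Vh k) * u k S) = (\<Sum>\<^sub>\<infinity>k. \<Sum>\<^sub>\<infinity>S\<in>slater N. of_real (Vh k) * u k S)"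
    by (rule infsum_swap_banach[OF vs, symmetric])
  finally show "form N \<Phi> (inter Vh \<Psi>) = of_real (1 / (2 * (2 * pi) ^ 3)) *
       (\<Sum>\<^sub>\<infinity>k. of_real (Vh k) * (form N (rho k \<Phi>) (rho k \<Psi>) - of_nat N * form N \<Phi> \<Psi>))"
    by (simp add: ip c_def)
qed

section \<open>Diagonal operators and the Fermi sea\<close>

definition Texc :: "real \<Rightarrow> mom set \<Rightarrow> real" where
  "Texc kF S = sum msq (S - fermi_ball kF) - sum msq (fermi_ball kF - S)"

lemma kin_eq: "finite S \<Longrightarrow> kin \<Psi> S = of_real (sum msq S) * \<Psi> S"
proof -
  assume S: "finite S"
  have "kin \<Psi> S = (\<Sum>\<^sub>\<infinity>p\<in>S. of_real (msq p) * \<Psi> S)"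
    unfolding kin_def by (rule infsum_cong_neutral) (auto simp: cre_ann_same)
  thus ?thesis using S by (simp add: sum_distrib_right)
qed

lemma sum_msq_eq:
  assumes "finite S"
  shows "sum msq S = sum msq (fermi_ball kF) + Texc kF S"
proof -
  have "sum msq S = sum msq (S \<inter> fermi_ball kF) + sum msq (S - fermi_ball kF)"
    using assms by (simp add: sum.Int_Diff[of S _ "fermi_ball kF"])
  moreover have "sum msq (fermi_ball kF) = sum msq (fermi_ball kF \<inter> S) + sum msq (fermi_ball kF - S)"
    by (simp add: sum.Int_Diff[of "fermi_ball kF" _ S])
  ultimately show ?thesis by (simp add: Texc_def Int_commute)
qed

lemma Hkin'_eq:
  assumes "finite S"
  shows "Hkin' kF \<Psi> S = of_real (Texc kF S) * \<Psi> S"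
proof -
  have "(\<Sum>\<^sub>\<infinity>p\<in>- fermi_ball kF. of_real (msq p) * cre p (ann p \<Psi>) S) = (\<Sum>\<^sub>\<infinity>p\<in>S - fermi_ball kF. of_real (msq p) * \<Psi> S)"
    by (rule infsum_cong_neutral) (auto simp: cre_ann_same)
  moreover have "(\<Sum>p\<in>fermi_ball kF. of_real (msq p) * ann p (cre p \<Psi>) S) = (\<Sum>p\<in>fermi_ball kF - S. of_real (msq p) * \<Psi> S)"
    by (rule sum.mono_neutral_cong_right) (auto simp: ann_cre_same)
  ultimately show ?thesis using assms
    by (simp add: Hkin'_def Texc_def algebra_simps sum_distrib_left)
qed

lemma NE_eq:
  assumes "finite S"
  shows "NE kF \<Psi> S = of_nat (nexc kF S) * \<Psi> S"
proof -
  have "NE kF \<Psi> S = (\<Sum>\<^sub>\<infinity>p\<in>S - fermi_ball kF. \<Psi> S)"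
    unfolding NE_def by (rule infsum_cong_neutral) (auto simp: cre_ann_same)
  thus ?thesis using assms by (simp add: nexc_def)
qed

text \<open>At fixed particle number there are as many holes as excited particles. Holes have energy
  at most z and particles at least z + 1, so each particle-hole pair costs at least 1.\<close>

lemma nexc_le_Texc:
  assumes S: "S \<in> slater (card (fermi_ball kF))" and "kF \<ge> 0"
  shows "real (nexc kF S) \<le> Texc kF S"
proof -
  define z where "z = real_of_int \<lfloor>kF\<^sup>2\<rfloor>"
  have fin: "finite S" and c: "card S = card (fermi_ball kF)" using S by (auto simp: slater_def)
  have ceq: "card (fermi_ball kF - S) = card (S - fermi_ball kF)"
    using c card_Int_Diff[OF fin, of "fermi_ball kF"] card_Int_Diff[of "fermi_ball kF" S] by (simp add: Int_commute)
  have p0: "(0,0,0) \<in> fermi_ball kF"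
    using assms(2) by (simp add: fermi_ball_def mnorm_def msq_def)
  have "sum msq (S - fermi_ball kF) \<ge> (\<Sum>p\<in>S - fermi_ball kF. z + 1)"
    unfolding z_def by (rule sum_mono) (rule msq_gap(2)[OF p0 _ assms(2)], blast)
  moreover have "sum msq (fermi_ball kF - S) \<le> (\<Sum>p\<in>fermi_ball kF - S. z)"
  \<comment> \<open>\<open>msq_gap\<close> asks for a point on each side. Without an excited
    particle there is no outer point at hand, but then there are no holes either.\<close>
  proof (cases "S - fermi_ball kF = {}")
    case True
    hence "card (fermi_ball kF - S) = 0" unfolding ceq by (simp only: card.empty)
    hence "fermi_ball kF - S = {}" by (simp only: card_eq_0_iff) simp
    thus ?thesis by (simp only: sum.empty)
  next
    case False
    then obtain q0 where "q0 \<notin> fermi_ball kF" by blast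
    thus ?thesis unfolding z_def by (intro sum_mono) (rule msq_gap(1)[OF _ _ assms(2)], blast+)
  qed
  ultimately show ?thesis
    by (simp add: Texc_def nexc_def ceq algebra_simps)
qed

lemma rho_0: "S \<in> slater N \<Longrightarrow> rho 0 \<Psi> S = of_nat N * \<Psi> S"
  by (simp add: rho_def cre_ann_same slater_def)

lemma form_rho_0: "form N (rho 0 \<Phi>) (rho 0 \<Psi>) = of_nat (N\<^sup>2) * form N \<Phi> \<Psi>"
proof -
  have "form N (rho 0 \<Phi>) (rho 0 \<Psi>) = (\<Sum>\<^sub>\<infinity>S\<in>slater N. of_nat (N\<^sup>2) * (cnj (\<Phi> S) * \<Psi> S))"
    unfolding form_def by (rule infsum_cong) (simp add: rho_0 power2_eq_square)
  thus ?thesis by (simp add: infsum_cmult_right' form_def del: of_nat_power)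
qed

lemma sinner_eq_form:
  assumes "\<And>S. S \<notin> slater N \<Longrightarrow> \<Phi> S = 0"
  shows "sinner \<Phi> \<Psi> = form N \<Phi> \<Psi>"
  unfolding sinner_def form_def by (rule infsum_cong_neutral) (use assms in auto)

lemma sqnorm_rho_0:
  assumes "l2 N \<Psi>"
  shows "sqnorm N (rho 0 \<Psi>) = (real N)\<^sup>2 * sqnorm N \<Psi>"
proof -
  have "complex_of_real (sqnorm N (rho 0 \<Psi>)) = complex_of_real ((real N)\<^sup>2 * sqnorm N \<Psi>)"
    using form_rho_0[of N \<Psi> \<Psi>] assms by (simp add: form_same l2_rho)
  thus ?thesis by (simp only: of_real_eq_iff)
qed

section \<open>Density fluctuations of the Fermi sea\<close>

lemma psiFS_facts:
  fixes kF :: real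
  defines "N \<equiv> card (fermi_ball kF)"
  shows "fermi_ball kF \<in> slater N" and "S \<notin> slater N \<Longrightarrow> psiFS kF S = 0"
    and "l2 N (psiFS kF)" and "sqnorm N (psiFS kF) = 1" and "nexp kF N (psiFS kF) = 0"
    and "sinner (psiFS kF) X = X (fermi_ball kF)"
proof -
  show B: "fermi_ball kF \<in> slater N" by (simp add: slater_def N_def)
  thus "S \<notin> slater N \<Longrightarrow> psiFS kF S = 0" by (auto simp: psiFS_def)
  have "((\<lambda>S. (cmod (psiFS kF S))\<^sup>2) has_sum 1) {fermi_ball kF}"
    by (rule has_sum_finiteI) (simp_all add: psiFS_def)
  hence hs: "((\<lambda>S. (cmod (psiFS kF S))\<^sup>2) has_sum 1) (slater N)"
    by (rule has_sum_cong_neutral[THEN iffD1, rotated 3]) (use B in \<open>auto simp: psiFS_def\<close>)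
  thus "l2 N (psiFS kF)" unfolding l2_def by (rule has_sum_imp_summable)
  show "sqnorm N (psiFS kF) = 1" unfolding sqnorm_def using infsumI[OF hs] .
  show "nexp kF N (psiFS kF) = 0"
    unfolding nexp_def by (rule infsum_0) (simp add: psiFS_def nexc_def)
  have "sinner (psiFS kF) X = (\<Sum>\<^sub>\<infinity>S\<in>{fermi_ball kF}. cnj (psiFS kF S) * X S)"
    unfolding sinner_def by (rule infsum_cong_neutral) (auto simp: psiFS_def)
  thus "sinner (psiFS kF) X = X (fermi_ball kF)" by (simp add: psiFS_def)
qed

text \<open>The commutator estimate is reused instead of a separate count. Since N_E annihilates the
  Fermi sea, the commutator applied to it is -N_E \<open>rho k\<close> psi_FS; for k \<noteq> 0 the
  vector \<open>rho k\<close> psi_FS has no Fermi sea component, and N_E \<ge> 1 on what remains.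
  The price is a factor 2.\<close>

lemma sqnorm_rho_psiFS_le:
  assumes "k \<noteq> 0" and N: "N = card (fermi_ball kF)"
  shows "sqnorm N (rho k (psiFS kF)) \<le> 2 * real (card (lune kF k))"
proof -
  note F = psiFS_facts[where kF = kF, folded N]
  have "sqnorm N (rho k (psiFS kF)) \<le> sqnorm N (rho_comm kF k (psiFS kF))"
    unfolding sqnorm_def
  proof (rule infsum_mono)
    show "(\<lambda>S. (cmod (rho k (psiFS kF) S))\<^sup>2) summable_on slater N"
      using l2_rho(1)[OF F(3)] by (simp add: l2_def)
    show "(\<lambda>S. (cmod (rho_comm kF k (psiFS kF) S))\<^sup>2) summable_on slater N"
      using sqnorm_rho_comm_le(1)[OF F(3)] by (simp add: l2_def)
    fix S assume S: "S \<in> slater N"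
    have "nmult kF (psiFS kF) = (\<lambda>_. 0)"
      by (auto simp: nmult_def psiFS_def nexc_def)
    hence eq: "rho_comm kF k (psiFS kF) S = - of_nat (nexc kF S) * rho k (psiFS kF) S"
      by (simp add: rho_comm_def rho_eq finite_slater[OF S])
    show "(cmod (rho k (psiFS kF) S))\<^sup>2 \<le> (cmod (rho_comm kF k (psiFS kF) S))\<^sup>2"
    proof (cases "nexc kF S = 0")
      case True
      hence "S \<subseteq> fermi_ball kF" using finite_slater[OF S] by (simp add: nexc_def)
      hence S': "S = fermi_ball kF" using S N by (intro card_subset_eq) (auto simp: slater_def)
      have "hop k S a \<noteq> fermi_ball kF" if "a \<in> hset k S" for a
        using that assms(1) by (auto simp: hop_def hset_def S')
      hence "rho k (psiFS kF) S = 0"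
        by (simp add: rho_eq finite_slater[OF S] psiFS_def)
      thus ?thesis by simp
    next
      case False
      hence "1 * cmod (rho k (psiFS kF) S) \<le> real (nexc kF S) * cmod (rho k (psiFS kF) S)"
        by (intro mult_right_mono) auto
      thus ?thesis by (intro power_mono) (auto simp: eq norm_mult)
    qed
  qed
  also have "\<dots> \<le> 2 * real (card (lune kF k))"
    using sqnorm_rho_comm_le(2)[OF F(3), of kF k] F by simp
  finally show ?thesis .
qed

text \<open>Pointwise, \<open>Re (cnj (n x + y) * x) \<ge> Re (cnj y * x)\<close> for \<open>n \<ge> 0\<close>: the diagonal part of
  \<open>\<rho>\<^sub>k n = n \<rho>\<^sub>k + [\<rho>\<^sub>k, n]\<close> has a favourable sign.\<close>

lemma Re_form_rho_nmult_ge: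
  assumes \<Psi>: "l2 N \<Psi>"
  shows "- Re (form N (rho k (nmult kF \<Psi>)) (rho k \<Psi>))
     \<le> (sqnorm N (rho_comm kF k \<Psi>) + sqnorm N (rho k \<Psi>)) / 2"
proof -
  define x where "x S = rho k \<Psi> S" for S
  define y where "y S = rho_comm kF k \<Psi> S" for S
  have rn: "rho k (nmult kF \<Psi>) S = of_nat (nexc kF S) * x S + y S" for S
    by (simp add: x_def y_def rho_comm_def)
  have "((\<lambda>S. - Re (cnj (rho k (nmult kF \<Psi>) S) * rho k \<Psi> S)) has_sum
     - Re (form N (rho k (nmult kF \<Psi>)) (rho k \<Psi>))) (slater N)"
    unfolding form_def
    by (intro has_sum_uminusI has_sum_Re has_sum_infsum form_summable l2_rho l2_nmult \<Psi>)
  moreover have "((\<lambda>S. ((cmod (y S))\<^sup>2 + (cmod (x S))\<^sup>2) * (1/2)) has_sum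
      (sqnorm N (rho_comm kF k \<Psi>) + sqnorm N (rho k \<Psi>)) * (1/2)) (slater N)"
    unfolding sqnorm_def x_def y_def
    by (intro has_sum_cmult_left has_sum_add has_sum_infsum
      sqnorm_rho_comm_le(1)[OF \<Psi>, unfolded l2_def] l2_rho(1)[OF \<Psi>, unfolded l2_def])
  moreover have "- Re (cnj (rho k (nmult kF \<Psi>) S) * rho k \<Psi> S) \<le> ((cmod (y S))\<^sup>2 + (cmod (x S))\<^sup>2) * (1/2)" for S
  proof -
    have "Re (cnj (of_nat (nexc kF S) * x S) * x S) = real (nexc kF S) * (cmod (x S))\<^sup>2"
      using cnj_mult_self[of "x S"] by (simp add: mult.assoc)
    hence 1: "Re (cnj (of_nat (nexc kF S) * x S) * x S) \<ge> 0" by simp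
    have "\<bar>Re (cnj (y S) * x S)\<bar> \<le> cmod (y S) * cmod (x S)"
      using abs_Re_le_cmod[of "cnj (y S) * x S"] by (simp add: norm_mult)
    moreover have "cmod (y S) * cmod (x S) \<le> ((cmod (y S))\<^sup>2 + (cmod (x S))\<^sup>2) * (1/2)"
      using sum_squares_bound[of "cmod (y S)" "cmod (x S)"] by simp
    moreover have "Re (cnj (rho k (nmult kF \<Psi>) S) * rho k \<Psi> S)
       = Re (cnj (of_nat (nexc kF S) * x S) * x S) + Re (cnj (y S) * x S)"
      unfolding rn x_def[symmetric] by (simp add: algebra_simps)
    ultimately show ?thesis using 1 by linarith
  qed
  ultimately show ?thesis using has_sum_mono by fastforce
qed

section \<open>Energy estimates\<close>

text \<open>The prefactor of \<open>inter\<close>: one half for unordered pairs, (2 pi)^(-3) from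
  the convention for the Fourier coefficients.\<close>

definition cV :: real where
  "cV = 1 / (2 * (2 * pi) ^ 3)"

lemma cV_pos: "cV > 0"
  by (simp add: cV_def)

lemma EFS_eq:
  assumes V: "Vh summable_on UNIV" "\<And>k. Vh k \<ge> 0" and N: "N = card (fermi_ball kF)"
  shows "(\<lambda>k. Vh k * (sqnorm N (rho k (psiFS kF)) - real N)) summable_on UNIV"
    and "EFS Vh kF = sum msq (fermi_ball kF)
      + cV / kF * (\<Sum>\<^sub>\<infinity>k. Vh k * (sqnorm N (rho k (psiFS kF)) - real N))"
proof -
  note F = psiFS_facts[where kF = kF, folded N]
  define r where "r k = Vh k * (sqnorm N (rho k (psiFS kF)) - real N)" for k
  have r: "of_real (Vh k) * (form N (rho k (psiFS kF)) (rho k (psiFS kF)) - of_nat N * form N (psiFS kF) (psiFS kF))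
     = of_real (r k)" for k
    unfolding form_same[OF F(3)] form_same[OF l2_rho(1)[OF F(3)]] F(4) by (simp add: r_def)
  have sc: "(\<lambda>k. complex_of_real (r k)) summable_on UNIV"
    using inter_form(1)[OF V F(3) F(3)] by (simp only: r)
  hence sr: "r summable_on UNIV" using summable_on_Re by fastforce
  thus "(\<lambda>k. Vh k * (sqnorm N (rho k (psiFS kF)) - real N)) summable_on UNIV"
    by (simp add: r_def [abs_def])
  have "inter Vh (psiFS kF) (fermi_ball kF) = form N (psiFS kF) (inter Vh (psiFS kF))"
    unfolding F(6)[symmetric] by (rule sinner_eq_form) (rule F(2))
  also have "\<dots> = of_real cV * (\<Sum>\<^sub>\<infinity>k. complex_of_real (r k))"
    using inter_form(2)[OF V F(3) F(3)] by (simp only: r cV_def)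
  also have "(\<Sum>\<^sub>\<infinity>k. complex_of_real (r k)) = of_real (infsum r UNIV)"
    by (intro infsumI has_sum_of_real has_sum_infsum sr)
  finally have i: "inter Vh (psiFS kF) (fermi_ball kF) = of_real cV * of_real (infsum r UNIV)" .
  have "psiFS kF (fermi_ball kF) = 1" by (simp add: psiFS_def)
  thus "EFS Vh kF = sum msq (fermi_ball kF)
      + cV / kF * (\<Sum>\<^sub>\<infinity>k. Vh k * (sqnorm N (rho k (psiFS kF)) - real N))"
    unfolding EFS_def F(6) HN_def kin_eq[OF finite_fermi_ball]
    by (simp add: i r_def [abs_def])
qed

text \<open>The eigenvalue equation tested against w \<Psi> for a bounded nonnegative weight w
  diagonal in the Slater basis, with E_FS times the weighted mass W subtracted. The choices w = 1
  and w = \<open>nexc\<close> give the two energy estimates.\<close>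

lemma weighted_energy_bound:
  assumes V: "Vh summable_on UNIV" "\<And>k. Vh k \<ge> 0" and N: "N = card (fermi_ball kF)"
    and kF: "kF > 0" and \<Psi>: "l2 N \<Psi>"
    and T: "(\<lambda>S. Texc kF S * (cmod (\<Psi> S))\<^sup>2) summable_on slater N"
    and w: "\<And>S. S \<in> slater N \<Longrightarrow> 0 \<le> w S" "\<And>S. S \<in> slater N \<Longrightarrow> w S \<le> B"
    and E: "\<And>S. S \<in> slater N \<Longrightarrow> HN Vh kF \<Psi> S = E * \<Psi> S"
    and Ele: "Re E \<le> EFS Vh kF + \<kappa> * kF"
    and W: "W = (\<Sum>\<^sub>\<infinity>S\<in>slater N. w S * (cmod (\<Psi> S))\<^sup>2)"
    and D: "D = (\<lambda>k. Vh k * (sqnorm N (rho k (psiFS kF)) * W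
                 - Re (form N (rho k (\<lambda>S. of_real (w S) * \<Psi> S)) (rho k \<Psi>))))"
  shows "(\<lambda>S. w S * Texc kF S * (cmod (\<Psi> S))\<^sup>2) summable_on slater N"
    and "D summable_on UNIV"
    and "(\<Sum>\<^sub>\<infinity>S\<in>slater N. w S * Texc kF S * (cmod (\<Psi> S))\<^sup>2) \<le> \<kappa> * kF * W + cV / kF * infsum D UNIV"
proof -
  define \<Phi> where "\<Phi> = (\<lambda>S. of_real (w S) * \<Psi> S)"
  define T0 where "T0 = sum msq (fermi_ball kF)"
  define X where "X = (\<Sum>\<^sub>\<infinity>S\<in>slater N. w S * Texc kF S * (cmod (\<Psi> S))\<^sup>2)"
  have \<Phi>: "l2 N \<Phi>"
    unfolding \<Phi>_def by (rule l2_mult_bounded[OF \<Psi>, where B = B]) (use w in \<open>simp\<close>)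
  have Tpos: "Texc kF S \<ge> 0" if "S \<in> slater N" for S
    using nexc_le_Texc[of S kF] that kF N by (intro order_trans[OF of_nat_0_le_iff]) auto
  show Xs: "(\<lambda>S. w S * Texc kF S * (cmod (\<Psi> S))\<^sup>2) summable_on slater N"
    by (rule summable_on_norm_le[OF summable_on_cmult_right[OF T, of B]])
       (use w Tpos in \<open>auto simp: abs_mult mult.assoc intro!: mult_right_mono\<close>)
  have Ws: "(\<lambda>S. w S * (cmod (\<Psi> S))\<^sup>2) summable_on slater N"
    by (rule summable_on_norm_le[OF summable_on_cmult_right[OF \<Psi>[unfolded l2_def], of B]])
       (use w in \<open>auto simp: abs_mult intro!: mult_right_mono\<close>)
  have Xc: "((\<lambda>S. complex_of_real (w S * Texc kF S * (cmod (\<Psi> S))\<^sup>2)) has_sum of_real X) (slater N)"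
    unfolding X_def by (intro has_sum_of_real has_sum_infsum Xs)
  have Wc: "((\<lambda>S. complex_of_real (w S * (cmod (\<Psi> S))\<^sup>2)) has_sum of_real W) (slater N)"
    unfolding W by (intro has_sum_of_real has_sum_infsum Ws)
  have cnj\<Phi>: "cnj (\<Phi> S) * \<Psi> S = of_real (w S * (cmod (\<Psi> S))\<^sup>2)" for S
    using cnj_mult_self[of "\<Psi> S"] by (simp add: \<Phi>_def mult.assoc)
  have ip: "form N \<Phi> \<Psi> = of_real W"
    unfolding form_def cnj\<Phi> by (rule infsumI[OF Wc])
  \<comment> \<open>Solving the eigenvalue equation for the interaction gives one value of its form;
    \<open>inter_form\<close> gives a second one, and comparing their real parts isolates the
    weighted kinetic energy.\<close>
  have "cnj (\<Phi> S) * inter Vh \<Psi> S = of_real kF * ((E - of_real T0) * of_real (w S * (cmod (\<Psi> S))\<^sup>2)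
          - of_real (w S * Texc kF S * (cmod (\<Psi> S))\<^sup>2))" if S: "S \<in> slater N" for S
  proof -
    have "E * \<Psi> S = of_real (T0 + Texc kF S) * \<Psi> S + of_real (1 / kF) * inter Vh \<Psi> S"
      using E[OF S] kin_eq[OF finite_slater[OF S], of \<Psi>] sum_msq_eq[OF finite_slater[OF S], of kF]
      by (simp add: HN_def T0_def)
    hence "inter Vh \<Psi> S = of_real kF * ((E - of_real T0) - of_real (Texc kF S)) * \<Psi> S"
      using kF by (simp add: field_simps)
    hence "cnj (\<Phi> S) * inter Vh \<Psi> S = of_real kF * ((E - of_real T0) - of_real (Texc kF S)) * (cnj (\<Phi> S) * \<Psi> S)"
      by simp
    thus ?thesis unfolding cnj\<Phi> by (simp add: algebra_simps)
  qed
  moreover have "((\<lambda>S. of_real kF * ((E - of_real T0) * of_real (w S * (cmod (\<Psi> S))\<^sup>2)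
          - of_real (w S * Texc kF S * (cmod (\<Psi> S))\<^sup>2))) has_sum
       (of_real kF * ((E - of_real T0) * of_real W - of_real X))) (slater N)"
    by (intro has_sum_cmult_right has_sum_diff Wc Xc)
  ultimately have f1: "form N \<Phi> (inter Vh \<Psi>) = of_real kF * ((E - of_real T0) * of_real W - of_real X)"
    unfolding form_def by (simp add: infsumI cong: infsum_cong)
  define Q where "Q k = form N (rho k \<Phi>) (rho k \<Psi>)" for k
  define q where "q k = of_real (Vh k) * (Q k - of_nat N * of_real W)" for k
  have qs: "q summable_on UNIV"
    using inter_form(1)[OF V \<Phi> \<Psi>] by (simp add: q_def [abs_def] Q_def ip)
  have f2: "form N \<Phi> (inter Vh \<Psi>) = of_real cV * infsum q UNIV"
    using inter_form(2)[OF V \<Phi> \<Psi>] by (simp add: q_def [abs_def] Q_def ip cV_def)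
  define F where "F k = sqnorm N (rho k (psiFS kF))" for k
  define r where "r k = Vh k * (F k - real N)" for k
  have rs: "r summable_on UNIV" using EFS_eq(1)[OF V N] by (simp add: r_def [abs_def] F_def)
  have EFS: "EFS Vh kF = T0 + cV / kF * infsum r UNIV"
    using EFS_eq(2)[OF V N] by (simp add: r_def [abs_def] F_def T0_def)
  have "Re (form N \<Phi> (inter Vh \<Psi>)) = kF * ((Re E - T0) * W - X)"
    by (simp add: f1)
  moreover have "Re (form N \<Phi> (inter Vh \<Psi>)) = cV * (\<Sum>\<^sub>\<infinity>k. Re (q k))"
    by (simp add: f2 infsum_Re[OF qs])
  ultimately have X: "X = (Re E - T0) * W - cV / kF * (\<Sum>\<^sub>\<infinity>k. Re (q k))"
    using kF by (simp add: field_simps)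
  \<comment> \<open>The contributions -N W of the Fermi sea and of \<Psi> cancel here, summand by
    summand.\<close>
  have Dk: "D = (\<lambda>k. r k * W - Re (q k))"
    unfolding D by (rule ext) (simp add: r_def q_def Q_def F_def \<Phi>_def algebra_simps)
  have "((\<lambda>k. r k * W + - Re (q k)) has_sum (infsum r UNIV * W + - (\<Sum>\<^sub>\<infinity>k. Re (q k)))) UNIV"
    by (intro has_sum_add has_sum_cmult_left has_sum_uminusI has_sum_infsum rs summable_on_Re qs)
  hence Dsum: "(D has_sum (infsum r UNIV * W - (\<Sum>\<^sub>\<infinity>k. Re (q k)))) UNIV"
    by (simp add: Dk)
  thus "D summable_on UNIV" by (rule has_sum_imp_summable)
  \<comment> \<open>The upper bound on the energy may be multiplied by W only because the weight is
    nonnegative.\<close>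
  have "W \<ge> 0" unfolding W using w by (intro infsum_nonneg) simp
  hence "(Re E - T0) * W \<le> (cV / kF * infsum r UNIV + \<kappa> * kF) * W"
    using Ele EFS by (intro mult_right_mono) auto
  hence "X \<le> \<kappa> * kF * W + cV / kF * (infsum r UNIV * W - (\<Sum>\<^sub>\<infinity>k. Re (q k)))"
    unfolding X by (simp add: algebra_simps)
  thus "(\<Sum>\<^sub>\<infinity>S\<in>slater N. w S * Texc kF S * (cmod (\<Psi> S))\<^sup>2) \<le> \<kappa> * kF * W + cV / kF * infsum D UNIV"
    unfolding infsumI[OF Dsum] X_def .
qed

text \<open>Nonzero lattice vectors have length at least 1, and the single term at 0 does not affect
  summability.\<close>

lemma summable_Vh:
  assumes "\<And>k. Vh k \<ge> 0" "(\<lambda>k. Vh k * mnorm k) summable_on UNIV"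
  shows "Vh summable_on UNIV"
proof -
  have "Vh summable_on (UNIV - {0})"
  proof (rule summable_on_norm_le)
    show "(\<lambda>k. Vh k * mnorm k) summable_on (UNIV - {0})"
      by (rule summable_on_subset_banach[OF assms(2)]) simp
    show "norm (Vh k) \<le> Vh k * mnorm k" if "k \<in> UNIV - {0}" for k
      using mnorm_ge_1[of k] that assms(1)[of k] mult_left_mono[of 1 "mnorm k" "Vh k"] by simp
  qed
  hence "Vh summable_on insert 0 (UNIV - {0})" by (subst summable_on_insert_iff)
  moreover have "insert 0 (UNIV - {0}) = (UNIV :: mom set)" by blast
  ultimately show ?thesis by (simp only:)
qed

text \<open>The constant A is scaled so that \<open>A * kF\<close> is the interaction cost of all
  lunes: 54 is 27 from the lune count times 2 from the Fermi sea bound, and kF^2 is reduced to kF by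
  the coupling.\<close>

lemma excitation_energy_bound:
  assumes Vpos: "\<And>k. Vh k \<ge> 0" and VM: "(\<lambda>k. Vh k * mnorm k) summable_on UNIV"
    and A: "A = 54 * cV * (\<Sum>\<^sub>\<infinity>k. Vh k * mnorm k)"
    and N: "N = card (fermi_ball kF)" and kF: "kF \<ge> 1" and \<kappa>: "\<kappa> > 0"
    and \<Psi>: "l2 N \<Psi>" and norm1: "sqnorm N \<Psi> = 1"
    and T: "(\<lambda>S. Texc kF S * (cmod (\<Psi> S))\<^sup>2) summable_on slater N"
    and E: "\<And>S. S \<in> slater N \<Longrightarrow> HN Vh kF \<Psi> S = E * \<Psi> S"
    and Ele: "Re E \<le> EFS Vh kF + \<kappa> * kF"
  defines "X1 \<equiv> (\<Sum>\<^sub>\<infinity>S\<in>slater N. Texc kF S * (cmod (\<Psi> S))\<^sup>2)"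
    and "Xn \<equiv> (\<Sum>\<^sub>\<infinity>S\<in>slater N. real (nexc kF S) * Texc kF S * (cmod (\<Psi> S))\<^sup>2)"
  shows "(\<lambda>S. real (nexc kF S) * Texc kF S * (cmod (\<Psi> S))\<^sup>2) summable_on slater N"
    and "X1 + Xn / kF \<le> (2 * (1 + A) + (1 + 2 * A)\<^sup>2) * (\<kappa> + 1)\<^sup>2 * kF"
proof -
  have V: "Vh summable_on UNIV" by (rule summable_Vh[OF Vpos VM])
  have kF0: "kF > 0" using kF by simp
  define M where "M = (\<Sum>\<^sub>\<infinity>k. Vh k * mnorm k)"
  have AM: "A = 54 * cV * M" by (simp add: A M_def)
  have "M \<ge> 0" unfolding M_def using Vpos by (intro infsum_nonneg) simp
  hence A0: "A \<ge> 0" using cV_pos by (simp add: AM)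
  define F where "F k = sqnorm N (rho k (psiFS kF))" for k
  \<comment> \<open>Set to 0 at k = 0, where the density norms of \<Psi> and of the Fermi sea are
    both N^2 and cancel. Bounds proportional to |k| then hold for every k.\<close>
  define q where "q k = (if k = 0 then 0 else sqnorm N (rho k \<Psi>))" for k
  define n where "n = nexp kF N \<Psi>"
  have n0: "n \<ge> 0" by (simp add: n_def nexp_nonneg)
  have q0: "q k \<ge> 0" for k by (simp add: q_def sqnorm_nonneg)
  have F0: "F 0 = (real N)\<^sup>2" using sqnorm_rho_0[of N "psiFS kF"] psiFS_facts[where kF = kF, folded N] by (simp add: F_def)
  have Fle: "F k \<le> 54 * kF\<^sup>2 * mnorm k" if "k \<noteq> 0" for k
    using sqnorm_rho_psiFS_le[OF that N] card_lune_le[OF kF, of k] by (simp add: F_def)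
  have qs: "(\<lambda>k. Vh k * q k) summable_on UNIV"
  proof (rule summable_on_norm_le[OF summable_on_cmult_left[OF V, of "(real N)\<^sup>2"]])
    show "norm (Vh k * q k) \<le> Vh k * (real N)\<^sup>2" for k
      using l2_rho(2)[OF \<Psi>, of k] Vpos[of k] q0[of k]
      by (auto simp: norm1 abs_mult q_def intro!: mult_left_mono)
  qed
  define R where "R = (\<Sum>\<^sub>\<infinity>k. Vh k * q k)"
  define P where "P = cV / kF * R"
  have P0: "P \<ge> 0" unfolding P_def R_def using Vpos q0 cV_pos kF0
    by (intro mult_nonneg_nonneg infsum_nonneg) auto

  \<comment> \<open>The test with w = 1. The density sum P is kept on the left, since the second
    test consumes it.\<close>
  have X1: "X1 + P \<le> (\<kappa> + A) * kF"
  proof -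
    define D where "D = (\<lambda>k. Vh k * (F k * 1 - Re (form N (rho k (\<lambda>S. of_real 1 * \<Psi> S)) (rho k \<Psi>))))"
    have W: "1 = (\<Sum>\<^sub>\<infinity>S\<in>slater N. 1 * (cmod (\<Psi> S))\<^sup>2)"
      using norm1 by (simp add: sqnorm_def)
    note B = weighted_energy_bound[where w = "\<lambda>_. 1" and B = 1, OF V Vpos N kF0 \<Psi> T _ _ E Ele W D_def[unfolded F_def], simplified]
    have "infsum D UNIV \<le> (\<Sum>\<^sub>\<infinity>k. 54 * kF\<^sup>2 * (Vh k * mnorm k) + (- 1) * (Vh k * q k))"
    proof (rule infsum_mono)
      show "D summable_on UNIV" by (rule B(2))
      show "(\<lambda>k. 54 * kF\<^sup>2 * (Vh k * mnorm k) + (- 1) * (Vh k * q k)) summable_on UNIV"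
        by (intro summable_on_add summable_on_cmult_right VM qs)
      fix k
      have "F k - sqnorm N (rho k \<Psi>) \<le> 54 * kF\<^sup>2 * mnorm k - q k"
        using Fle[of k] F0 sqnorm_rho_0[OF \<Psi>] norm1 by (cases "k = 0") (auto simp: q_def)
      from mult_left_mono[OF this Vpos[of k]]
      show "D k \<le> 54 * kF\<^sup>2 * (Vh k * mnorm k) + (- 1) * (Vh k * q k)"
        by (simp add: D_def form_same l2_rho \<Psi> algebra_simps)
    qed
    also have "\<dots> = 54 * kF\<^sup>2 * M + (- 1) * R"
      unfolding M_def R_def infsum_cmult_right'[symmetric]
      by (intro infsum_add summable_on_cmult_right VM qs)
    finally have "cV / kF * infsum D UNIV \<le> cV / kF * (54 * kF\<^sup>2 * M + (- 1) * R)"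
      using cV_pos kF0 by (intro mult_left_mono) auto
    also have "\<dots> = A * kF - P"
      using kF0 by (simp add: AM P_def field_simps power2_eq_square)
    finally show ?thesis using B(3) by (simp add: X1_def algebra_simps)
  qed

  have nX: "n \<le> X1"
    unfolding n_def nexp_def X1_def
  proof (rule infsum_mono[OF nexp_summable[OF \<Psi>] T])
    show "real (nexc kF S) * (cmod (\<Psi> S))\<^sup>2 \<le> Texc kF S * (cmod (\<Psi> S))\<^sup>2" if "S \<in> slater N" for S
      using nexc_le_Texc[of S kF] that N kF0 by (intro mult_right_mono) auto
  qed

  define D where "D = (\<lambda>k. Vh k * (F k * n - Re (form N (rho k (\<lambda>S. of_real (real (nexc kF S)) * \<Psi> S)) (rho k \<Psi>))))"
  have W: "n = (\<Sum>\<^sub>\<infinity>S\<in>slater N. real (nexc kF S) * (cmod (\<Psi> S))\<^sup>2)"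
    by (simp add: n_def nexp_def)
  have wB: "real (nexc kF S) \<le> real N" if "S \<in> slater N" for S
    using nexc_le[OF that] by simp
  note B = weighted_energy_bound[OF V Vpos N kF0 \<Psi> T of_nat_0_le_iff wB E Ele W D_def[unfolded F_def]]
  show "(\<lambda>S. real (nexc kF S) * Texc kF S * (cmod (\<Psi> S))\<^sup>2) summable_on slater N"
    by (rule B(1))
  have "infsum D UNIV \<le> (\<Sum>\<^sub>\<infinity>k. (54 * kF\<^sup>2 * n + 27 * kF\<^sup>2 * (2 * n + 1)) * (Vh k * mnorm k) + (1 / 2) * (Vh k * q k))"
  proof (rule infsum_mono)
    show "D summable_on UNIV" by (rule B(2))
    show "(\<lambda>k. (54 * kF\<^sup>2 * n + 27 * kF\<^sup>2 * (2 * n + 1)) * (Vh k * mnorm k) + (1 / 2) * (Vh k * q k)) summable_on UNIV"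
      by (intro summable_on_add summable_on_cmult_right VM qs)
    fix k
    have nm: "(\<lambda>S. complex_of_real (real (nexc kF S)) * \<Psi> S) = nmult kF \<Psi>"
      by (simp add: nmult_def [abs_def])
    define Q where "Q = Re (form N (rho k (nmult kF \<Psi>)) (rho k \<Psi>))"
    \<comment> \<open>The first term bounds the Fermi sea weighted with n. The second is half of the
      squared commutator, whose factor 2 the half removes, and q k / 2 is the remaining half of the
      split product.\<close>
    have "F k * n - Q \<le> (54 * kF\<^sup>2 * n + 27 * kF\<^sup>2 * (2 * n + 1)) * mnorm k + (1 / 2) * q k"
    proof (cases "k = 0")
      \<comment> \<open>At k = 0 both terms equal N^2 n, so the difference is 0.\<close>
      case True
      have "((\<lambda>S. complex_of_real (real (nexc kF S) * (cmod (\<Psi> S))\<^sup>2)) has_sum of_real n) (slater N)"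
        unfolding W by (intro has_sum_of_real has_sum_infsum nexp_summable \<Psi>)
      moreover have "cnj (nmult kF \<Psi> S) * \<Psi> S = complex_of_real (real (nexc kF S) * (cmod (\<Psi> S))\<^sup>2)" for S
        using cnj_mult_self[of "\<Psi> S"] by (simp add: nmult_def mult.assoc)
      ultimately have "form N (nmult kF \<Psi>) \<Psi> = of_real n"
        unfolding form_def by (simp add: infsumI)
      hence "Q = (real N)\<^sup>2 * n"
        unfolding Q_def True form_rho_0 by simp
      thus ?thesis using F0 True n0 by (simp add: q_def)
    next
      case False
      define s where "s = sqnorm N (rho_comm kF k \<Psi>)"
      define b where "b = (27 * kF\<^sup>2 * mnorm k) * (2 * n + 1)"
      define f where "f = 54 * kF\<^sup>2 * mnorm k * n"
      have "- Q \<le> (s + sqnorm N (rho k \<Psi>)) / 2"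
        unfolding Q_def s_def by (rule Re_form_rho_nmult_ge[OF \<Psi>])
      moreover have "s \<le> 2 * b"
      proof -
        have "s \<le> 2 * (real (card (lune kF k)) * (2 * n + 1))"
          using sqnorm_rho_comm_le(2)[OF \<Psi>, of kF k] by (simp add: n_def s_def norm1)
        also have "\<dots> \<le> 2 * b"
          unfolding b_def by (intro mult_left_mono mult_right_mono card_lune_le[OF kF]) (use n0 in simp_all)
        finally show ?thesis .
      qed
      moreover have "F k * n \<le> f"
        unfolding f_def using Fle[OF False] n0 by (rule mult_right_mono)
      moreover have "(54 * kF\<^sup>2 * n + 27 * kF\<^sup>2 * (2 * n + 1)) * mnorm k = f + b"
        unfolding f_def b_def by algebra
      moreover have "q k = sqnorm N (rho k \<Psi>)" using False by (simp add: q_def)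
      ultimately show ?thesis by argo
    qed
    from mult_left_mono[OF this Vpos[of k]]
    show "D k \<le> (54 * kF\<^sup>2 * n + 27 * kF\<^sup>2 * (2 * n + 1)) * (Vh k * mnorm k) + (1 / 2) * (Vh k * q k)"
      unfolding D_def nm Q_def by (simp only: distrib_left mult.left_commute)
  qed
  also have "\<dots> = (54 * kF\<^sup>2 * n + 27 * kF\<^sup>2 * (2 * n + 1)) * M + (1 / 2) * R"
    unfolding M_def R_def infsum_cmult_right'[symmetric]
    by (intro infsum_add summable_on_cmult_right VM qs)
  finally have "cV / kF * infsum D UNIV \<le> cV / kF * ((54 * kF\<^sup>2 * n + 27 * kF\<^sup>2 * (2 * n + 1)) * M + (1 / 2) * R)"
    using cV_pos kF0 by (intro mult_left_mono) auto
  also have "\<dots> = A * kF * n + A * kF * n + A * kF / 2 + P / 2"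
    using kF0 by (simp add: AM P_def field_simps power2_eq_square)
  finally have "Xn \<le> (\<kappa> + 2 * A) * kF * n + A * kF / 2 + P / 2"
    using B(3) by (simp add: Xn_def algebra_simps)
  \<comment> \<open>The first estimate bounds n and P by \<open>(\<kappa> + A) * kF\<close>. The
    terms of order kF are raised to order kF^2, which is where kF \<ge> 1 is used.\<close>
  also have "\<dots> \<le> (\<kappa> + 2 * A) * kF * ((\<kappa> + A) * kF) + (\<kappa> + A) * kF * kF"
  proof -
    have X10: "X1 \<ge> 0" using n0 nX by simp
    have "(\<kappa> + 2 * A) * kF * n \<le> (\<kappa> + 2 * A) * kF * ((\<kappa> + A) * kF)"
      using nX X1 P0 A0 \<kappa> kF0 by (intro mult_left_mono) auto
    moreover have "P \<le> (\<kappa> + A) * kF" using X1 X10 by simp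
    moreover have "A * kF \<le> (\<kappa> + A) * kF" using \<kappa> kF0 by (intro mult_right_mono) auto
    moreover have "(\<kappa> + A) * kF * 1 \<le> (\<kappa> + A) * kF * kF"
      using \<kappa> kF A0 by (intro mult_left_mono) auto
    ultimately show ?thesis by linarith
  qed
  also have "\<dots> = ((\<kappa> + 2 * A) * (\<kappa> + A) + (\<kappa> + A)) * kF * kF"
    by (simp add: algebra_simps)
  finally have "Xn / kF \<le> ((\<kappa> + 2 * A) * (\<kappa> + A) + (\<kappa> + A)) * kF"
    using kF0 by (simp add: divide_le_eq)
  moreover have "X1 \<le> (\<kappa> + A) * kF" using X1 P0 by simp
  ultimately have "X1 + Xn / kF \<le> (2 * (\<kappa> + A) + (\<kappa> + 2 * A) * (\<kappa> + A)) * kF"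
    by (simp add: algebra_simps)
  \<comment> \<open>Each factor is compared with a multiple of \<kappa> + 1, and the linear term is
    raised to a square because \<kappa> + 1 \<ge> 1. What is left depends on A only, hence on V
    only.\<close>
  also have "\<dots> \<le> ((2 * (1 + A) + (1 + 2 * A)\<^sup>2) * (\<kappa> + 1)\<^sup>2) * kF"
  proof (rule mult_right_mono)
    have "\<kappa> + A \<le> (1 + A) * (\<kappa> + 1)" using A0 \<kappa> by (simp add: algebra_simps)
    also have "\<dots> \<le> (1 + A) * (\<kappa> + 1)\<^sup>2"
      using A0 \<kappa> by (intro mult_left_mono) (auto simp: power2_eq_square algebra_simps)
    finally have e1: "\<kappa> + A \<le> (1 + A) * (\<kappa> + 1)\<^sup>2" .
    have e2: "(\<kappa> + 2 * A) * (\<kappa> + A) \<le> ((1 + 2 * A) * (\<kappa> + 1)) * ((1 + 2 * A) * (\<kappa> + 1))"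
      using A0 \<kappa> by (intro mult_mono) (auto simp: algebra_simps)
    have e3: "(2 * (1 + A) + (1 + 2 * A)\<^sup>2) * (\<kappa> + 1)\<^sup>2
        = 2 * ((1 + A) * (\<kappa> + 1)\<^sup>2) + ((1 + 2 * A) * (\<kappa> + 1)) * ((1 + 2 * A) * (\<kappa> + 1))"
      by algebra
    show "2 * (\<kappa> + A) + (\<kappa> + 2 * A) * (\<kappa> + A) \<le> (2 * (1 + A) + (1 + 2 * A)\<^sup>2) * (\<kappa> + 1)\<^sup>2"
      unfolding e3 by (intro add_mono mult_left_mono e1 e2) simp
  qed (use kF0 in simp)
  finally show "X1 + Xn / kF \<le> (2 * (1 + A) + (1 + 2 * A)\<^sup>2) * (\<kappa> + 1)\<^sup>2 * kF" .
qed

theorem mainTheorem2: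
  fixes Vh :: "mom \<Rightarrow> real"
  assumes "\<forall>k. Vh k \<ge> 0"
    and "\<forall>k. Vh (mneg k) = Vh k"
    and "(\<lambda>k. Vh k * mnorm k) summable_on UNIV"
  shows "\<exists>C>0. \<forall>kF::real. \<forall>\<kappa>::real. \<forall>\<Psi>::state.
     (kF \<ge> 1 \<and> \<kappa> > 0 \<and> in_dom_Hkin' kF \<Psi> \<and> sinner \<Psi> \<Psi> = 1
      \<and> (\<exists>E::complex. \<forall>S. HN Vh kF \<Psi> S = E * \<Psi> S)
      \<and> Re (sinner \<Psi> (HN Vh kF \<Psi>)) \<le> EFS Vh kF + \<kappa> * kF)
     \<longrightarrow> Re (sinner \<Psi> (\<lambda>S. Hkin' kF \<Psi> S + of_real (1 / kF) * NE kF (Hkin' kF \<Psi>) S))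
         \<le> C * (\<kappa> + 1)^2 * kF"
proof -
  define A where "A = 54 * cV * (\<Sum>\<^sub>\<infinity>k. Vh k * mnorm k)"
  have "(\<Sum>\<^sub>\<infinity>k. Vh k * mnorm k) \<ge> 0" using assms(1) by (intro infsum_nonneg mult_nonneg_nonneg mnorm_nonneg) blast
  hence A0: "A \<ge> 0" using cV_pos by (simp add: A_def)
  have main: "Re (sinner \<Psi> (\<lambda>S. Hkin' kF \<Psi> S + of_real (1 / kF) * NE kF (Hkin' kF \<Psi>) S))
         \<le> (2 * (1 + A) + (1 + 2 * A)\<^sup>2) * (\<kappa> + 1)^2 * kF"
    if kF: "kF \<ge> 1" and \<kappa>: "\<kappa> > 0" and dom: "in_dom_Hkin' kF \<Psi>" and norm: "sinner \<Psi> \<Psi> = 1"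
      and E: "\<And>S. HN Vh kF \<Psi> S = E * \<Psi> S"
      and le: "Re (sinner \<Psi> (HN Vh kF \<Psi>)) \<le> EFS Vh kF + \<kappa> * kF" for kF \<kappa> \<Psi> E
  proof -
    define N where "N = card (fermi_ball kF)"
    have supp: "\<Psi> S = 0" if "S \<notin> slater N" for S
      using dom that by (auto simp: in_dom_Hkin'_def in_HN_space_def slater_def N_def)
    have \<Psi>: "l2 N \<Psi>"
      using dom unfolding in_dom_Hkin'_def in_HN_space_def l2_def
      by (blast intro: summable_on_subset_banach[OF _ subset_UNIV])
    have norm1: "sqnorm N \<Psi> = 1"
      using norm sinner_eq_form[of N \<Psi> \<Psi>, OF supp] form_same[OF \<Psi>] by simp
    have Tpos: "Texc kF S \<ge> 0" if "S \<in> slater N" for S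
      using nexc_le_Texc[of S kF] that kF N_def by (intro order_trans[OF of_nat_0_le_iff]) auto
    have "(\<lambda>S. (cmod (Hkin' kF \<Psi> S))\<^sup>2) summable_on slater N"
      using dom unfolding in_dom_Hkin'_def
      by (blast intro: summable_on_subset_banach[OF _ subset_UNIV])
    hence "(\<lambda>S. (cmod (Hkin' kF \<Psi> S))\<^sup>2 + (cmod (\<Psi> S))\<^sup>2) summable_on slater N"
      using \<Psi> by (intro summable_on_add) (auto simp: l2_def)
    \<comment> \<open>Finite kinetic energy from membership in the operator domain: T |\<Psi>|^2 is
      the product of T |\<Psi>| and |\<Psi>|, both square summable.\<close>
    hence T: "(\<lambda>S. Texc kF S * (cmod (\<Psi> S))\<^sup>2) summable_on slater N"
    proof (rule summable_on_norm_le)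
      fix S assume S: "S \<in> slater N"
      have "Texc kF S * (cmod (\<Psi> S))\<^sup>2 = (Texc kF S * cmod (\<Psi> S)) * cmod (\<Psi> S)"
        by (simp add: power2_eq_square)
      also have "\<dots> \<le> (Texc kF S * cmod (\<Psi> S))\<^sup>2 + (cmod (\<Psi> S))\<^sup>2" by (rule mult_le_sum_squares)
      also have "Texc kF S * cmod (\<Psi> S) = cmod (Hkin' kF \<Psi> S)"
        using Tpos[OF S] by (simp add: Hkin'_eq[OF finite_slater[OF S]] norm_mult)
      finally show "norm (Texc kF S * (cmod (\<Psi> S))\<^sup>2) \<le> (cmod (Hkin' kF \<Psi> S))\<^sup>2 + (cmod (\<Psi> S))\<^sup>2"
        using Tpos[OF S] by (simp add: abs_mult)
    qed
    \<comment> \<open>For a normalized eigenvector the energy expectation is E itself, so the energy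
      assumption becomes a bound on \<open>Re E\<close>.\<close>
    have "sinner \<Psi> (HN Vh kF \<Psi>) = E * sinner \<Psi> \<Psi>"
      unfolding sinner_def infsum_cmult_right'[symmetric] by (rule infsum_cong) (simp add: E)
    hence Ele: "Re E \<le> EFS Vh kF + \<kappa> * kF" using le norm by simp
    note B = excitation_energy_bound[OF _ assms(3) A_def N_def kF \<kappa> \<Psi> norm1 T E Ele]
    define X1 where "X1 = (\<Sum>\<^sub>\<infinity>S\<in>slater N. Texc kF S * (cmod (\<Psi> S))\<^sup>2)"
    define Xn where "Xn = (\<Sum>\<^sub>\<infinity>S\<in>slater N. real (nexc kF S) * Texc kF S * (cmod (\<Psi> S))\<^sup>2)"
    have "((\<lambda>S. complex_of_real (Texc kF S * (cmod (\<Psi> S))\<^sup>2 + 1 / kF * (real (nexc kF S) * Texc kF S * (cmod (\<Psi> S))\<^sup>2)))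
        has_sum of_real (X1 + 1 / kF * Xn)) (slater N)"
      unfolding X1_def Xn_def
      by (intro has_sum_of_real has_sum_add has_sum_cmult_right has_sum_infsum T B(1)) (use assms(1) in auto)
    moreover have "cnj (\<Psi> S) * (Hkin' kF \<Psi> S + of_real (1 / kF) * NE kF (Hkin' kF \<Psi>) S)
       = complex_of_real (Texc kF S * (cmod (\<Psi> S))\<^sup>2 + 1 / kF * (real (nexc kF S) * Texc kF S * (cmod (\<Psi> S))\<^sup>2))"
      if S: "S \<in> slater N" for S
    proof -
      have "cnj (\<Psi> S) * (Hkin' kF \<Psi> S + of_real (1 / kF) * NE kF (Hkin' kF \<Psi>) S)
        = of_real (Texc kF S + 1 / kF * (real (nexc kF S) * Texc kF S)) * (cnj (\<Psi> S) * \<Psi> S)"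
        using finite_slater[OF S] by (simp add: NE_eq Hkin'_eq algebra_simps)
      thus ?thesis unfolding cnj_mult_self by (simp add: algebra_simps)
    qed
    ultimately have "form N \<Psi> (\<lambda>S. Hkin' kF \<Psi> S + of_real (1 / kF) * NE kF (Hkin' kF \<Psi>) S) = of_real (X1 + 1 / kF * Xn)"
      unfolding form_def by (simp only: infsumI cong: infsum_cong)
    hence "Re (sinner \<Psi> (\<lambda>S. Hkin' kF \<Psi> S + of_real (1 / kF) * NE kF (Hkin' kF \<Psi>) S)) = X1 + Xn / kF"
      by (subst sinner_eq_form[of N, OF supp]) simp_all
    thus ?thesis using B(2) assms(1) unfolding X1_def Xn_def by simp
  qed
  have "2 * (1 + A) + (1 + 2 * A)\<^sup>2 > 0" using A0 by (intro add_pos_nonneg) auto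
  thus ?thesis using main by blast
qed

end
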